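(* The $C$-field and its dual in M-theory define an $L_\infty$-algebra as their gauge algebra.
   Context: In eleven-dimensional supergravity, the low energy limit of M-theory, the $C$-field is a $3$-form potential $C_3$ with field strength $G_4=dC_3$. It satisfies the Bianchi identity $dG_4=0$ and the equation of motion $d{*G_4}=-\tfrac12 G_4\wedge G_4$, where $*$ is the Hodge star. The dual of the $C$-field is the potential $C_6$ of the dual field strength $G_7=*G_4=dC_6-\tfrac12 C_3\wedge G_4$. This first order equation is invariant under the infinitesimal gauge transformations $\delta C_3=\Lambda_3$, $\delta C_6=\Lambda_6-\tfrac12\Lambda_3\wedge C_3$, with $d\Lambda_3=0=d\Lambda_6$. The gauge algebra is the algebra generated by a generator $v_3$ (odd) for the $\Lambda_3$-transformations and a generator $v_6$ (even) for the $\Lambda_6$-transformations, whose only nonvanishing graded bracket is that of $v_3$ with itself, which is a multiple of $v_6$ (the other brackets are $[v_3,v_6]=0=[v_6,v_6]$). An $L_\infty$-algebra is a homotopy Lie algebra: a graded vector space with $n$-ary brackets satisfying the Jacobi identities up to coherent homotopy; a graded Lie algebra is a special case. In this language the fields are combined into the form $A=G_4\otimes v_3+( *G_4)\otimes v_6$ with values in the algebra. *)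

theory Defs
  imports "HOL-Analysis.Analysis"
begin

section \<open>Smooth manifolds\<close>

text \<open>
  A manifold is a whole type carrying a Hausdorff, second countable topology, with an atlas
  \<open>A\<close> of charts \<open>(U, \<phi>)\<close>; only the values of \<open>\<phi>\<close> on \<open>U\<close> matter.
  \<open>C_diff_on k S f\<close> is meant for open \<open>S\<close>.
\<close>

primrec C_diff_on :: "nat \<Rightarrow> (real ^ 'n) set \<Rightarrow> (real ^ 'n \<Rightarrow> real) \<Rightarrow> bool" where
  "C_diff_on 0 S f \<longleftrightarrow> continuous_on S f"
| "C_diff_on (Suc k) S f \<longleftrightarrow>
     f differentiable_on S \<and>
     (\<forall>i. C_diff_on k S (\<lambda>y. frechet_derivative f (at y) (axis i 1)))"

definition smooth_on :: "(real ^ 'n) set \<Rightarrow> (real ^ 'n \<Rightarrow> real) \<Rightarrow> bool" where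
  "smooth_on S f \<longleftrightarrow> (\<forall>k. C_diff_on k S f)"

type_synonym ('m, 'n) atlas = "('m set \<times> ('m \<Rightarrow> real ^ 'n)) set"

definition smooth_atlas :: "('m::topological_space, 'n::finite) atlas \<Rightarrow> bool" where
  "smooth_atlas A \<longleftrightarrow>
     (\<Union>(U, \<phi>)\<in>A. U) = UNIV \<and>
     (\<forall>(U, \<phi>)\<in>A. open U \<and> open (\<phi> ` U) \<and> (\<exists>\<psi>. homeomorphism U (\<phi> ` U) \<phi> \<psi>)) \<and>
     (\<forall>(U, \<phi>)\<in>A. \<forall>(V, \<psi>)\<in>A. \<forall>i. smooth_on (\<phi> ` (U \<inter> V)) (\<lambda>y. \<psi> (inv_into U \<phi> y) $ i))"

definition smooth_funs :: "('m::topological_space, 'n::finite) atlas \<Rightarrow> ('m \<Rightarrow> real) set" where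
  "smooth_funs A = {f. \<forall>(U, \<phi>)\<in>A. smooth_on (\<phi> ` U) (\<lambda>y. f (inv_into U \<phi> y))}"


section \<open>Vector fields and differential forms\<close>

text \<open>
  Vector fields are the derivations of the algebra of smooth functions, and \<open>k\<close>-forms are the
  alternating maps on \<open>k\<close>-tuples of vector fields that are multilinear over the smooth functions.
  Both are extended by zero outside their domain, so that equality of vector fields and of forms
  is equality of functions.
\<close>

type_synonym 'm vfield = "('m \<Rightarrow> real) \<Rightarrow> ('m \<Rightarrow> real)"
type_synonym 'm dform = "'m vfield list \<Rightarrow> 'm \<Rightarrow> real"

definition vfields :: "('m::topological_space, 'n::finite) atlas \<Rightarrow> 'm vfield set" where
  "vfields A = {X.
     (\<forall>f. f \<notin> smooth_funs A \<longrightarrow> X f = (\<lambda>_. 0)) \<and>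
     (\<forall>f\<in>smooth_funs A. X f \<in> smooth_funs A) \<and>
     (\<forall>f\<in>smooth_funs A. \<forall>h\<in>smooth_funs A. \<forall>a b.
        X (\<lambda>x. a * f x + b * h x) = (\<lambda>x. a * X f x + b * X h x)) \<and>
     (\<forall>f\<in>smooth_funs A. \<forall>h\<in>smooth_funs A.
        X (\<lambda>x. f x * h x) = (\<lambda>x. X f x * h x + f x * X h x))}"

definition vf_comb :: "('m \<Rightarrow> real) \<Rightarrow> 'm vfield \<Rightarrow> ('m \<Rightarrow> real) \<Rightarrow> 'm vfield \<Rightarrow> 'm vfield" where
  "vf_comb f X h Y = (\<lambda>u x. f x * X u x + h x * Y u x)"

definition lie_bracket :: "'m vfield \<Rightarrow> 'm vfield \<Rightarrow> 'm vfield" where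
  "lie_bracket X Y = (\<lambda>f x. X (Y f) x - Y (X f) x)"

definition dforms :: "('m::topological_space, 'n::finite) atlas \<Rightarrow> nat \<Rightarrow> 'm dform set" where
  "dforms A k = {\<omega>.
     (\<forall>Xs. \<not> (length Xs = k \<and> set Xs \<subseteq> vfields A) \<longrightarrow> \<omega> Xs = (\<lambda>_. 0)) \<and>
     (\<forall>Xs. length Xs = k \<and> set Xs \<subseteq> vfields A \<longrightarrow> \<omega> Xs \<in> smooth_funs A) \<and>
     (\<forall>Xs i. \<forall>X\<in>vfields A. \<forall>Y\<in>vfields A. \<forall>f\<in>smooth_funs A. \<forall>h\<in>smooth_funs A.
        length Xs = k \<and> set Xs \<subseteq> vfields A \<and> i < k \<longrightarrow>
        \<omega> (Xs[i := vf_comb f X h Y]) = (\<lambda>x. f x * \<omega> (Xs[i := X]) x + h x * \<omega> (Xs[i := Y]) x)) \<and>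
     (\<forall>Xs. \<not> distinct Xs \<longrightarrow> \<omega> Xs = (\<lambda>_. 0))}"

text \<open>
  The shuffle formula
  \<open>(\<alpha> \<and> \<beta>)(X\<^sub>0, \<dots>, X\<^sub>n) = \<Sum>\<^sub>S \<plusminus> \<alpha>(X\<^sub>i | i \<in> S) \<beta>(X\<^sub>j | j \<notin> S)\<close>. For \<open>\<alpha>\<close> of degree
  \<open>p\<close> only the sets \<open>S\<close> of cardinality \<open>p\<close> contribute, because \<open>\<alpha>\<close> vanishes on lists of any
  other length. The sign is that of the shuffle moving \<open>S\<close> to the front.
\<close>

definition inversions :: "nat set \<Rightarrow> nat \<Rightarrow> (nat \<times> nat) set" where
  "inversions S n = {(a, b). a < b \<and> b < n \<and> a \<notin> S \<and> b \<in> S}"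

definition wedge :: "'m dform \<Rightarrow> 'm dform \<Rightarrow> 'm dform" where
  "wedge \<alpha> \<beta> = (\<lambda>Xs x. \<Sum>S\<in>Pow {..<length Xs}.
     (- 1) ^ card (inversions S (length Xs)) * \<alpha> (nths Xs S) x * \<beta> (nths Xs (- S)) x)"

text \<open>
  Koszul's formula, without a normalising factor (the convention matching that of \<open>wedge\<close>).
\<close>

definition ext_d :: "('m::topological_space, 'n::finite) atlas \<Rightarrow> 'm dform \<Rightarrow> 'm dform" where
  "ext_d A \<omega> = (\<lambda>Xs x.
     if set Xs \<subseteq> vfields A then
       (\<Sum>i<length Xs. (- 1) ^ i * (Xs ! i) (\<omega> (nths Xs (- {i}))) x) +
       (\<Sum>j<length Xs. \<Sum>i<j. (- 1) ^ (i + j) *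
          \<omega> (lie_bracket (Xs ! i) (Xs ! j) # nths Xs (- {i, j})) x)
     else 0)"


section \<open>Eleven-dimensional oriented Lorentzian manifolds and the Hodge star\<close>

type_synonym 'm metric = "'m vfield \<Rightarrow> 'm vfield \<Rightarrow> 'm \<Rightarrow> real"

text \<open>
  Signature \<open>(-, +, \<dots>, +)\<close>. Eleven vector fields that are orthonormal at \<open>p\<close> form a basis of the
  tangent space at \<open>p\<close>, so nondegeneracy is included.
\<close>

definition lorentzian_metric :: "('m::topological_space, 11) atlas \<Rightarrow> 'm metric \<Rightarrow> bool" where
  "lorentzian_metric A g \<longleftrightarrow>
     (\<forall>X\<in>vfields A. \<forall>Y\<in>vfields A. g X Y \<in> smooth_funs A \<and> g X Y = g Y X) \<and>
     (\<forall>X\<in>vfields A. \<forall>Y\<in>vfields A. \<forall>Z\<in>vfields A. \<forall>f\<in>smooth_funs A. \<forall>h\<in>smooth_funs A.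
        g (vf_comb f X h Y) Z = (\<lambda>x. f x * g X Z x + h x * g Y Z x)) \<and>
     (\<forall>p. \<exists>e :: 11 \<Rightarrow> 'm vfield. range e \<subseteq> vfields A \<and>
        (\<forall>i j. g (e i) (e j) p = (if i \<noteq> j then 0 else if i = 0 then - 1 else 1)))"

text \<open>
  The metric volume form satisfies
  \<open>vol(X\<^sub>0, \<dots>, X\<^sub>1\<^sub>0) vol(Y\<^sub>0, \<dots>, Y\<^sub>1\<^sub>0) = sgn(det g) det g(X\<^sub>i, Y\<^sub>j)\<close>. This
  fixes it locally up to sign, and a global solution is the choice of an orientation.
\<close>

definition frame_list :: "(11 \<Rightarrow> 'm vfield) \<Rightarrow> 'm vfield list" where
  "frame_list X = map (\<lambda>k. X (of_nat k)) [0..<11]"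

definition volume_form ::
    "('m::topological_space, 11) atlas \<Rightarrow> 'm metric \<Rightarrow> 'm dform \<Rightarrow> bool" where
  "volume_form A g vol \<longleftrightarrow> vol \<in> dforms A 11 \<and>
     (\<forall>X Y :: 11 \<Rightarrow> 'm vfield. range X \<subseteq> vfields A \<and> range Y \<subseteq> vfields A \<longrightarrow>
        (\<forall>p. vol (frame_list X) p * vol (frame_list Y) p
              = - det (\<chi> i j. g (X i) (Y j) p)))"

definition lorentzian_spacetime ::
    "('m::topological_space, 11) atlas \<Rightarrow> 'm metric \<Rightarrow> 'm dform \<Rightarrow> bool" where
  "lorentzian_spacetime A g vol \<longleftrightarrow>
     smooth_atlas A \<and> lorentzian_metric A g \<and> volume_form A g vol"

definition flat_form ::
    "('m::topological_space, 'n::finite) atlas \<Rightarrow> 'm metric \<Rightarrow> 'm vfield \<Rightarrow> 'm dform" where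
  "flat_form A g Y = (\<lambda>Xs. if length Xs = 1 \<and> set Xs \<subseteq> vfields A then g Y (hd Xs) else (\<lambda>_. 0))"

primrec flat_wedge ::
    "('m::topological_space, 'n::finite) atlas \<Rightarrow> 'm metric \<Rightarrow> 'm vfield list \<Rightarrow> 'm dform" where
  "flat_wedge A g [] = (\<lambda>Xs x. if Xs = [] then 1 else 0)"
| "flat_wedge A g (Y # Ys) = wedge (flat_form A g Y) (flat_wedge A g Ys)"

text \<open>
  The defining property \<open>\<alpha> \<and> *\<omega> = \<langle>\<alpha>, \<omega>\<rangle> vol\<close> for all \<open>p\<close>-forms \<open>\<alpha>\<close>, where the metric on
  \<open>p\<close>-forms is given on \<open>\<alpha> = Y\<^sub>1\<^sup>\<flat> \<and> \<dots> \<and> Y\<^sub>p\<^sup>\<flat>\<close> by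
  \<open>\<langle>\<alpha>, \<omega>\<rangle> = \<omega>(Y\<^sub>1, \<dots>, Y\<^sub>p)\<close>; such \<open>\<alpha>\<close> span all \<open>p\<close>-forms.
\<close>

definition hodge_star ::
    "('m::topological_space, 11) atlas \<Rightarrow> 'm metric \<Rightarrow> 'm dform \<Rightarrow> nat \<Rightarrow> 'm dform \<Rightarrow> 'm dform" where
  "hodge_star A g vol p \<omega> = (THE \<eta>. \<eta> \<in> dforms A (11 - p) \<and>
     (\<forall>Ys. length Ys = p \<and> set Ys \<subseteq> vfields A \<longrightarrow>
        wedge (flat_wedge A g Ys) \<eta> = (\<lambda>Xs x. \<omega> Ys x * vol Xs x)))"


section \<open>The C-field, its dual, and their gauge transformations\<close>

datatype gauge_gen = V3 | V6

instance gauge_gen :: finite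
proof
  have "(UNIV :: gauge_gen set) \<subseteq> {V3, V6}"
    using gauge_gen.exhaust by blast
  then show "finite (UNIV :: gauge_gen set)"
    by (rule finite_subset) (intro finite.intros)
qed

primrec gen_deg :: "gauge_gen \<Rightarrow> nat" where
  "gen_deg V3 = 3"
| "gen_deg V6 = 6"

text \<open>
  A family \<open>\<Lambda> :: 'm gforms\<close> with \<open>\<Lambda> a\<close> of degree \<open>gen_deg a\<close> stands both for the pair
  \<open>(\<Lambda> V3, \<Lambda> V6)\<close> and for \<open>\<Lambda> V3 \<otimes> v\<^sub>3 + \<Lambda> V6 \<otimes> v\<^sub>6\<close>.
\<close>

type_synonym 'm gforms = "gauge_gen \<Rightarrow> 'm dform"

definition potentials :: "('m::topological_space, 'n::finite) atlas \<Rightarrow> 'm gforms set" where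
  "potentials A = {C. \<forall>a. C a \<in> dforms A (gen_deg a)}"

definition gauge_parameters :: "('m::topological_space, 'n::finite) atlas \<Rightarrow> 'm gforms set" where
  "gauge_parameters A = {\<Lambda>. \<forall>a. \<Lambda> a \<in> dforms A (gen_deg a) \<and> ext_d A (\<Lambda> a) = (\<lambda>_ _. 0)}"

text \<open>
  The left-hand sides of \<open>dG\<^sub>4 = 0\<close>, \<open>d*G\<^sub>4 + (1/2) G\<^sub>4 \<and> G\<^sub>4 = 0\<close> and
  \<open>*G\<^sub>4 - (dC\<^sub>6 - (1/2) C\<^sub>3 \<and> G\<^sub>4) = 0\<close>, where \<open>G\<^sub>4 = dC\<^sub>3\<close>.
\<close>

definition field_strength :: "('m::topological_space, 'n::finite) atlas \<Rightarrow> 'm gforms \<Rightarrow> 'm dform" where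
  "field_strength A C = ext_d A (C V3)"

definition bianchi_lhs :: "('m::topological_space, 'n::finite) atlas \<Rightarrow> 'm gforms \<Rightarrow> 'm dform" where
  "bianchi_lhs A C = ext_d A (field_strength A C)"

definition eom_lhs ::
    "('m::topological_space, 11) atlas \<Rightarrow> 'm metric \<Rightarrow> 'm dform \<Rightarrow> 'm gforms \<Rightarrow> 'm dform" where
  "eom_lhs A g vol C = (\<lambda>Xs x.
     ext_d A (hodge_star A g vol 4 (field_strength A C)) Xs x
     + 1 / 2 * wedge (field_strength A C) (field_strength A C) Xs x)"

definition duality_lhs ::
    "('m::topological_space, 11) atlas \<Rightarrow> 'm metric \<Rightarrow> 'm dform \<Rightarrow> 'm gforms \<Rightarrow> 'm dform" where
  "duality_lhs A g vol C = (\<lambda>Xs x.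
     hodge_star A g vol 4 (field_strength A C) Xs x
     - (ext_d A (C V6) Xs x - 1 / 2 * wedge (C V3) (field_strength A C) Xs x))"

definition field_equations ::
    "('m::topological_space, 11) atlas \<Rightarrow> 'm metric \<Rightarrow> 'm dform \<Rightarrow> ('m gforms \<Rightarrow> 'm dform) set" where
  "field_equations A g vol = {bianchi_lhs A, eom_lhs A g vol, duality_lhs A g vol}"

definition solutions ::
    "('m::topological_space, 11) atlas \<Rightarrow> 'm metric \<Rightarrow> 'm dform \<Rightarrow> 'm gforms set" where
  "solutions A g vol =
     {C \<in> potentials A. \<forall>E\<in>field_equations A g vol. E C = (\<lambda>_ _. 0)}"

text \<open>
  The variation \<open>\<delta>C\<close> is a vector field on the space of potentials:
  \<open>\<delta>C\<^sub>3 = \<Lambda>\<^sub>3\<close>, \<open>\<delta>C\<^sub>6 = \<Lambda>\<^sub>6 - (1/2) \<Lambda>\<^sub>3 \<and> C\<^sub>3\<close>.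
\<close>

primrec gauge_variation :: "'m gforms \<Rightarrow> 'm gforms \<Rightarrow> 'm gforms" where
  "gauge_variation \<Lambda> C V3 = \<Lambda> V3"
| "gauge_variation \<Lambda> C V6 = (\<lambda>Xs x. \<Lambda> V6 Xs x - 1 / 2 * wedge (\<Lambda> V3) (C V3) Xs x)"

text \<open>
  \<open>has_variation F C D V\<close>: the derivative at \<open>C\<close> of the form-valued functional \<open>F\<close> in the
  direction \<open>D\<close> is \<open>V\<close>.
\<close>

definition has_variation ::
    "('m gforms \<Rightarrow> 'm dform) \<Rightarrow> 'm gforms \<Rightarrow> 'm gforms \<Rightarrow> 'm dform \<Rightarrow> bool" where
  "has_variation F C D V \<longleftrightarrow>
     (\<forall>Xs x. ((\<lambda>t. F (\<lambda>a Ys y. C a Ys y + t * D a Ys y) Xs x)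
                has_real_derivative V Xs x) (at 0))"

definition infinitesimal_symmetry ::
    "('m::topological_space, 11) atlas \<Rightarrow> 'm metric \<Rightarrow> 'm dform \<Rightarrow> ('m gforms \<Rightarrow> 'm gforms) \<Rightarrow> bool" where
  "infinitesimal_symmetry A g vol \<xi> \<longleftrightarrow>
     (\<forall>C\<in>potentials A. \<xi> C \<in> potentials A) \<and>
     (\<forall>C\<in>solutions A g vol. \<forall>E\<in>field_equations A g vol. has_variation E C (\<xi> C) (\<lambda>_ _. 0))"

text \<open>
  \<open>\<zeta> = [\<xi>, \<eta>]\<close> as vector fields on the space of potentials, that is
  \<open>\<zeta> = D\<eta>(\<xi>) - D\<xi>(\<eta>)\<close>, the commutator of \<open>\<xi>\<close> and \<open>\<eta>\<close> acting as derivations on functionals.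
\<close>

definition is_commutator ::
    "('m::topological_space, 'n::finite) atlas \<Rightarrow> ('m gforms \<Rightarrow> 'm gforms) \<Rightarrow>
     ('m gforms \<Rightarrow> 'm gforms) \<Rightarrow> ('m gforms \<Rightarrow> 'm gforms) \<Rightarrow> bool" where
  "is_commutator A \<xi> \<eta> \<zeta> \<longleftrightarrow>
     (\<forall>C\<in>potentials A. \<forall>a. \<exists>P Q.
        has_variation (\<lambda>C'. \<eta> C' a) C (\<xi> C) P \<and>
        has_variation (\<lambda>C'. \<xi> C' a) C (\<eta> C) Q \<and>
        \<zeta> C a = (\<lambda>Xs x. P Xs x - Q Xs x))"


section \<open>L-infinity algebras\<close>

text \<open>
  Homological convention of Lada and Stasheff: the \<open>n\<close>-ary bracket \<open>l n\<close> (\<open>n \<ge> 1\<close>) has degree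
  \<open>n - 2\<close> and is graded antisymmetric, and the generalised Jacobi identities read
  \<open>\<Sum>\<^sub>i \<Sum>\<^sub>\<sigma> \<chi>(\<sigma>) (-1)\<^bsup>i(j-1)\<^esup> l\<^sub>j(l\<^sub>i(x\<^sub>\<sigma>\<^sub>(\<^sub>1\<^sub>), \<dots>, x\<^sub>\<sigma>\<^sub>(\<^sub>i\<^sub>)), x\<^sub>\<sigma>\<^sub>(\<^sub>i\<^sub>+\<^sub>1\<^sub>), \<dots>, x\<^sub>\<sigma>\<^sub>(\<^sub>n\<^sub>)) = 0\<close>
  with \<open>i + j = n + 1\<close> and \<open>\<sigma>\<close> running over the \<open>(i, n - i)\<close>-unshuffles, encoded by the set \<open>S\<close>
  of the first \<open>i\<close> positions. Here \<open>\<chi>(\<sigma>)\<close> is the signature times the Koszul sign,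
  a product over the inversions of \<open>\<sigma>\<close> of \<open>-(-1)\<^bsup>|x||y|\<^esup>\<close>.
\<close>

definition graded_vector_space :: "(int \<Rightarrow> 'v::real_vector set) \<Rightarrow> bool" where
  "graded_vector_space V \<longleftrightarrow>
     (\<forall>k. subspace (V k)) \<and>
     (\<forall>x. \<exists>!f. (\<forall>k. f k \<in> V k) \<and> finite {k. f k \<noteq> 0} \<and> x = (\<Sum>k | f k \<noteq> 0. f k))"

definition homogeneous :: "(int \<Rightarrow> 'v set) \<Rightarrow> int list \<Rightarrow> 'v list \<Rightarrow> bool" where
  "homogeneous V ds xs \<longleftrightarrow> list_all2 (\<lambda>d x. x \<in> V d) ds xs"

definition swap_sign :: "int \<Rightarrow> int \<Rightarrow> real" where
  "swap_sign d e = (if odd d \<and> odd e then 1 else - 1)"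

definition perm_sign :: "int list \<Rightarrow> (nat \<Rightarrow> nat) \<Rightarrow> real" where
  "perm_sign ds \<sigma> = (\<Prod>(a, b)\<in>{(a, b). a < b \<and> b < length ds \<and> \<sigma> b < \<sigma> a}.
     swap_sign (ds ! \<sigma> a) (ds ! \<sigma> b))"

definition unshuffle_sign :: "int list \<Rightarrow> nat set \<Rightarrow> real" where
  "unshuffle_sign ds S = (\<Prod>(a, b)\<in>inversions S (length ds). swap_sign (ds ! a) (ds ! b))"

definition L_infinity_algebra ::
    "(int \<Rightarrow> 'v::real_vector set) \<Rightarrow> (nat \<Rightarrow> 'v list \<Rightarrow> 'v) \<Rightarrow> bool" where
  "L_infinity_algebra V l \<longleftrightarrow>
     graded_vector_space V \<and>
     (\<forall>n\<ge>1. \<forall>xs i. length xs = n \<and> i < n \<longrightarrow> linear (\<lambda>x. l n (xs[i := x]))) \<and>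
     (\<forall>n\<ge>1. \<forall>ds xs. length xs = n \<and> homogeneous V ds xs \<longrightarrow>
        l n xs \<in> V (sum_list ds + int n - 2)) \<and>
     (\<forall>n\<ge>1. \<forall>ds xs \<sigma>. length xs = n \<and> homogeneous V ds xs \<and> \<sigma> permutes {..<n} \<longrightarrow>
        l n (map (\<lambda>i. xs ! \<sigma> i) [0..<n]) = perm_sign ds \<sigma> *\<^sub>R l n xs) \<and>
     (\<forall>n\<ge>1. \<forall>ds xs. length xs = n \<and> homogeneous V ds xs \<longrightarrow>
        (\<Sum>i=1..n. \<Sum>S | S \<subseteq> {..<n} \<and> card S = i.
           ((- 1) ^ (i * (n - i)) * unshuffle_sign ds S) *\<^sub>R
           l (n - i + 1) (l i (nths xs S) # nths xs (- S))) = 0)"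


section \<open>The gauge algebra\<close>

definition gen :: "gauge_gen \<Rightarrow> real ^ gauge_gen" where
  "gen a = axis a 1"

definition gauge_grading :: "int \<Rightarrow> (real ^ gauge_gen) set" where
  "gauge_grading k = {x. \<forall>a. x $ a \<noteq> 0 \<longrightarrow> int (gen_deg a) = k}"

text \<open>
  The bilinear bracket with \<open>[v\<^sub>3, v\<^sub>3] = -v\<^sub>6\<close> and \<open>[v\<^sub>3, v\<^sub>6] = [v\<^sub>6, v\<^sub>3] = [v\<^sub>6, v\<^sub>6] = 0\<close>.
\<close>

definition gauge_bracket :: "real ^ gauge_gen \<Rightarrow> real ^ gauge_gen \<Rightarrow> real ^ gauge_gen" where
  "gauge_bracket x y = (x $ V3 * y $ V3) *\<^sub>R (- gen V6)"

definition gauge_brackets :: "nat \<Rightarrow> (real ^ gauge_gen) list \<Rightarrow> real ^ gauge_gen" where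
  "gauge_brackets n xs = (if n = 2 then gauge_bracket (xs ! 0) (xs ! 1) else 0)"

text \<open>
  The bracket on form-valued elements,
  \<open>[\<alpha> \<otimes> v\<^sub>a, \<beta> \<otimes> v\<^sub>b] = (-1)\<^bsup>|v\<^sub>a||\<beta>|\<^esup> \<alpha> \<and> \<beta> \<otimes> [v\<^sub>a, v\<^sub>b]\<close>,
  for families whose component along \<open>v\<^sub>b\<close> has form degree \<open>|v\<^sub>b|\<close>.
\<close>

definition parameter_bracket :: "'m gforms \<Rightarrow> 'm gforms \<Rightarrow> 'm gforms" where
  "parameter_bracket \<Lambda> \<Lambda>' = (\<lambda>c Xs x. \<Sum>a\<in>UNIV. \<Sum>b\<in>UNIV.
     (- 1) ^ (gen_deg a * gen_deg b) * gauge_brackets 2 [gen a, gen b] $ c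
     * wedge (\<Lambda> a) (\<Lambda>' b) Xs x)"

end

(* The variation of C_3 is closed, so G_4, and with it the Bianchi identity and the second order
   equation of motion, is unchanged; the change of dC_6 cancels that of C_3 G_4 / 2 by the graded
   Leibniz rule. The commutator of two variations is computed by graded commutativity of the wedge
   product. At a point, the wedge product and both halves of Koszul's formula obey recursions that
   peel the first vector field off the argument list, and in this form the two product rules are
   inductions on lists which use neither alternation nor the combinatorics of shuffles. *)

theory Submission
  imports Defs
begin

text \<open>Neither half of Koszul's formula is a form by itself: in general the derivative half is
  not linear over the smooth functions. The calculus is therefore set up for arbitrary real
  functions on lists, with signs read off from list lengths; form degrees enter only at the end,
  through the supports of the factors. The Hodge star is a definite description and is never
  evaluated. \<open>G_4\<close> is literally the same function along the whole line C + t \<delta>C,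
  for every real t, so its star is the same too, and all three field equations are constant along
  that line. The constant in \<open>[v_3, v_3] = - v_6\<close> comes from two signs. The commutator
  of two variations consists of two halves, which add up to \<Lambda>_3 \<and> \<Lambda>'_3 because
  3-forms anticommute; moving the odd \<open>v_3\<close> past a 3-form costs one more sign, which
  the minus in the bracket cancels.\<close>

section \<open>Smooth functions\<close>

text \<open>The sum and product rules determine \<open>frechet_derivative\<close> only at points of
  \<open>S\<close>. Openness of \<open>S\<close> makes derivatives there independent of values
  elsewhere, so these formulas may be substituted into the recursion.\<close>

lemma C_diff_on_cong:
  assumes "open S" "\<And>y. y \<in> S \<Longrightarrow> f y = g y" "C_diff_on k S f"
  shows "C_diff_on k S g"
  using assms(2,3)
proof (induction k arbitrary: f g)
  case 0
  then show ?case by (simp cong: continuous_on_cong)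
next
  case (Suc k)
  have f: "f differentiable at y" if "y \<in> S" for y
    using Suc.prems(2) that assms(1) by (auto simp: differentiable_on_eq_differentiable_at)
  have g: "g differentiable at y" if y: "y \<in> S" for y
  proof -
    obtain D where "(f has_derivative D) (at y)" using f[OF y] unfolding differentiable_def ..
    then have "(g has_derivative D) (at y)"
      by (rule has_derivative_transform_within_open[OF _ assms(1) y]) (rule Suc.prems(1))
    then show ?thesis unfolding differentiable_def by blast
  qed
  have eq: "frechet_derivative f (at y) = frechet_derivative g (at y)" if "y \<in> S" for y
    using frechet_derivative_transform_within_open[OF f[OF that] assms(1) that Suc.prems(1)] .
  have "C_diff_on k S (\<lambda>y. frechet_derivative g (at y) (axis i 1))" for i
    by (rule Suc.IH[of "\<lambda>y. frechet_derivative f (at y) (axis i 1)"])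
      (use Suc.prems(2) in \<open>auto simp: eq\<close>)
  then show ?case
    using g assms(1) by (auto simp: differentiable_on_eq_differentiable_at)
qed

text \<open>The derivative of a product contains undifferentiated factors, which are given to order
  \<open>Suc k\<close> but wanted to order \<open>k\<close>.\<close>

lemma C_diff_on_Suc_imp: "C_diff_on (Suc k) S f \<Longrightarrow> C_diff_on k S f"
proof (induction k arbitrary: f)
  case 0
  then show ?case by (simp add: differentiable_imp_continuous_on)
next
  case (Suc k)
  then show ?case
    using C_diff_on.simps(2)[of "Suc k" S f] C_diff_on.simps(2)[of k S f] by blast
qed

lemma C_diff_on_const: "C_diff_on k S (\<lambda>_. c)"
  by (induction k arbitrary: c) auto

lemma C_diff_on_lincomb:
  assumes "open S" "C_diff_on k S f" "C_diff_on k S g"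
  shows "C_diff_on k S (\<lambda>y. a * f y + b * g y)"
  using assms(2,3)
proof (induction k arbitrary: f g)
  case 0
  then show ?case by (auto intro!: continuous_intros)
next
  case (Suc k)
  have d: "f differentiable at y" "g differentiable at y" if "y \<in> S" for y
    using Suc.prems that assms(1) by (auto simp: differentiable_on_eq_differentiable_at)
  have "frechet_derivative (\<lambda>y. a * f y + b * g y) (at y) =
      (\<lambda>v. a * frechet_derivative f (at y) v + b * frechet_derivative g (at y) v)"
    if "y \<in> S" for y
    using d[OF that] unfolding frechet_derivative_works
    by (intro frechet_derivative_at[symmetric]) (auto intro!: derivative_eq_intros)
  moreover have "C_diff_on k S (\<lambda>y. a * frechet_derivative f (at y) (axis i 1)
      + b * frechet_derivative g (at y) (axis i 1))" for i
    using Suc by auto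
  ultimately have "C_diff_on k S (\<lambda>y. frechet_derivative (\<lambda>y. a * f y + b * g y) (at y) (axis i 1))"
    for i
    by (intro C_diff_on_cong[OF assms(1) _ \<open>C_diff_on k S _\<close>]) auto
  moreover have "(\<lambda>y. a * f y + b * g y) differentiable_on S"
    using Suc.prems by (auto intro!: derivative_intros)
  ultimately show ?case by simp
qed

lemma C_diff_on_mult:
  assumes "open S" "C_diff_on k S f" "C_diff_on k S g"
  shows "C_diff_on k S (\<lambda>y. f y * g y)"
  using assms(2,3)
proof (induction k arbitrary: f g)
  case 0
  then show ?case by (auto intro!: continuous_intros)
next
  case (Suc k)
  have d: "f differentiable at y" "g differentiable at y" if "y \<in> S" for y
    using Suc.prems that assms(1) by (auto simp: differentiable_on_eq_differentiable_at)
  \<comment> \<open>The factors 1 give the derivative the shape of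
    \<open>C_diff_on_lincomb\<close>.\<close>
  have "frechet_derivative (\<lambda>y. f y * g y) (at y) =
      (\<lambda>v. 1 * (f y * frechet_derivative g (at y) v) + 1 * (frechet_derivative f (at y) v * g y))"
    if "y \<in> S" for y
    using d[OF that] unfolding frechet_derivative_works
    by (intro frechet_derivative_at[symmetric]) (auto intro!: derivative_eq_intros)
  moreover have "C_diff_on k S (\<lambda>y. 1 * (f y * frechet_derivative g (at y) (axis i 1))
      + 1 * (frechet_derivative f (at y) (axis i 1) * g y))" for i
    using Suc.prems C_diff_on_Suc_imp[OF Suc.prems(1)] C_diff_on_Suc_imp[OF Suc.prems(2)]
    by (intro C_diff_on_lincomb Suc.IH assms(1)) auto
  ultimately have "C_diff_on k S (\<lambda>y. frechet_derivative (\<lambda>y. f y * g y) (at y) (axis i 1))" for i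
    by (intro C_diff_on_cong[OF assms(1) _ \<open>C_diff_on k S _\<close>]) auto
  moreover have "(\<lambda>y. f y * g y) differentiable_on S"
    using Suc.prems by (auto intro!: derivative_intros)
  ultimately show ?case by simp
qed

lemma smooth_funs_const: "(\<lambda>_. c) \<in> smooth_funs A"
  by (auto simp: smooth_funs_def smooth_on_def C_diff_on_const)

lemma smooth_atlas_open: "smooth_atlas A \<Longrightarrow> (U, \<phi>) \<in> A \<Longrightarrow> open (\<phi> ` U)"
  by (fastforce simp: smooth_atlas_def)

lemma smooth_funs_lincomb:
  assumes "smooth_atlas A" "f \<in> smooth_funs A" "h \<in> smooth_funs A"
  shows "(\<lambda>x. a * f x + b * h x) \<in> smooth_funs A"
  using assms(2,3) unfolding smooth_funs_def smooth_on_def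
  by (auto intro!: C_diff_on_lincomb smooth_atlas_open[OF assms(1)])

lemma smooth_funs_mult:
  assumes "smooth_atlas A" "f \<in> smooth_funs A" "h \<in> smooth_funs A"
  shows "(\<lambda>x. f x * h x) \<in> smooth_funs A"
  using assms(2,3) unfolding smooth_funs_def smooth_on_def
  by (auto intro!: C_diff_on_mult smooth_atlas_open[OF assms(1)])

lemma smooth_funs_cmult:
  assumes "smooth_atlas A" "f \<in> smooth_funs A"
  shows "(\<lambda>x. c * f x) \<in> smooth_funs A"
  using smooth_funs_mult[OF assms(1) smooth_funs_const assms(2)] .

lemma smooth_funs_add:
  assumes "smooth_atlas A" "f \<in> smooth_funs A" "h \<in> smooth_funs A"
  shows "(\<lambda>x. f x + h x) \<in> smooth_funs A"
  using smooth_funs_lincomb[OF assms, of 1 1] by simp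

section \<open>Vector fields as derivations\<close>

lemma vfield_lincomb:
  "X \<in> vfields A \<Longrightarrow> f \<in> smooth_funs A \<Longrightarrow> h \<in> smooth_funs A \<Longrightarrow>
     X (\<lambda>x. a * f x + b * h x) = (\<lambda>x. a * X f x + b * X h x)"
  unfolding vfields_def by blast

lemma vfield_mult:
  "X \<in> vfields A \<Longrightarrow> f \<in> smooth_funs A \<Longrightarrow> h \<in> smooth_funs A \<Longrightarrow>
     X (\<lambda>x. f x * h x) = (\<lambda>x. X f x * h x + f x * X h x)"
  unfolding vfields_def by blast

lemma vfield_add:
  "X \<in> vfields A \<Longrightarrow> f \<in> smooth_funs A \<Longrightarrow> h \<in> smooth_funs A \<Longrightarrow>
     X (\<lambda>x. f x + h x) = (\<lambda>x. X f x + X h x)"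
  using vfield_lincomb[of X A f h 1 1] by simp

lemma vfield_cmult:
  "X \<in> vfields A \<Longrightarrow> f \<in> smooth_funs A \<Longrightarrow> X (\<lambda>x. c * f x) = (\<lambda>x. c * X f x)"
  using vfield_lincomb[of X A f f c 0] by simp

lemma vfield_zero: "X \<in> vfields A \<Longrightarrow> X (\<lambda>_. 0) = (\<lambda>_. 0)"
  using vfield_cmult[of X A "\<lambda>_. 0" 0] by (simp add: smooth_funs_const)


section \<open>The shuffle product of functions on lists\<close>

primrec shuffle :: "('a list \<Rightarrow> real) \<Rightarrow> ('a list \<Rightarrow> real) \<Rightarrow> 'a list \<Rightarrow> real" where
  "shuffle a b [] = a [] * b []"
| "shuffle a b (Z # Zs) = shuffle (\<lambda>Ys. a (Z # Ys)) b Zs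
     + shuffle (\<lambda>Ys. (- 1) ^ length Ys * a Ys) (\<lambda>Ys. b (Z # Ys)) Zs"

text \<open>Position 0 is already in front, so selecting it creates no inversion.\<close>

lemma inversions_Suc_insert:
  "card (inversions (insert 0 (Suc ` S)) (Suc n)) = card (inversions S n)"
proof -
  have "inversions (insert 0 (Suc ` S)) (Suc n) = map_prod Suc Suc ` inversions S n"
    (is "?L = ?R")
  proof (intro equalityI subsetI)
    fix p assume "p \<in> ?L"
    then show "p \<in> ?R"
      by (cases p; case_tac "fst p"; case_tac "snd p") (auto simp: inversions_def image_iff)
  qed (auto simp: inversions_def)
  moreover have "inj_on (map_prod Suc Suc) (inversions S n)" by (auto simp: inj_on_def)
  ultimately show ?thesis by (simp add: card_image)
qed

text \<open>An unselected position 0 precedes every selected one; these \<open>card S\<close>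
  inversions are the source of the length sign in \<open>shuffle\<close>.\<close>

lemma inversions_Suc_image:
  assumes "S \<subseteq> {..<n}"
  shows "card (inversions (Suc ` S) (Suc n)) = card S + card (inversions S n)"
proof -
  have "inversions (Suc ` S) (Suc n) = (\<lambda>b. (0, Suc b)) ` S \<union> map_prod Suc Suc ` inversions S n"
    (is "?L = ?R")
  proof (intro equalityI subsetI)
    fix p assume "p \<in> ?L"
    then show "p \<in> ?R"
      by (cases p; case_tac "fst p"; case_tac "snd p") (auto simp: inversions_def image_iff)
  qed (use assms in \<open>auto simp: inversions_def\<close>)
  moreover have "finite (inversions S n)"
    by (rule finite_subset[of _ "{..<n} \<times> {..<n}"]) (auto simp: inversions_def)
  moreover have "finite S" using assms finite_subset by blast
  moreover have "(\<lambda>b. (0, Suc b)) ` S \<inter> map_prod Suc Suc ` inversions S n = {}" by auto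
  moreover have "inj_on (map_prod Suc Suc) (inversions S n)" "inj_on (\<lambda>b. (0 :: nat, Suc b)) S"
    by (auto simp: inj_on_def)
  ultimately show ?thesis by (simp add: card_Un_disjoint card_image)
qed

lemma Pow_lessThan_Suc:
  "Pow {..<Suc n} = (\<lambda>S. insert 0 (Suc ` S)) ` Pow {..<n} \<union> (\<lambda>S. Suc ` S) ` Pow {..<n}"
proof -
  have "Pow (Suc ` {..<n}) = (\<lambda>S. Suc ` S) ` Pow {..<n}"
    by (rule image_Pow_surj[symmetric]) (rule refl)
  then show ?thesis
    by (simp only: lessThan_Suc_eq_insert_0 Pow_insert image_image Un_commute)
qed

text \<open>Sets containing position 0 give the first summand of the recursion and the others the
  second, where \<open>length (nths Zs S) = card S\<close> turns the additional inversions into the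
  length sign.\<close>

lemma shuffle_eq_sum:
  "shuffle a b Xs = (\<Sum>S\<in>Pow {..<length Xs}.
     (- 1) ^ card (inversions S (length Xs)) * a (nths Xs S) * b (nths Xs (- S)))"
proof (induction Xs arbitrary: a b)
  case Nil
  then show ?case by (simp add: inversions_def)
next
  case (Cons Z Zs)
  let ?n = "length Zs"
  let ?g = "\<lambda>S. (- 1) ^ card (inversions S (Suc ?n)) * a (nths (Z # Zs) S) * b (nths (Z # Zs) (- S))"
  have inj: "inj_on (\<lambda>S. insert 0 (Suc ` S)) (Pow {..<?n})" "inj_on (\<lambda>S. Suc ` S) (Pow {..<?n})"
    by (auto simp: inj_on_def)
  have "sum ?g (Pow {..<Suc ?n}) =
      (\<Sum>S\<in>Pow {..<?n}. ?g (insert 0 (Suc ` S))) + (\<Sum>S\<in>Pow {..<?n}. ?g (Suc ` S))"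
    unfolding Pow_lessThan_Suc
    by (subst sum.union_disjoint) (auto simp: sum.reindex[OF inj(1)] sum.reindex[OF inj(2)])
  also have "(\<Sum>S\<in>Pow {..<?n}. ?g (insert 0 (Suc ` S))) = shuffle (\<lambda>Ys. a (Z # Ys)) b Zs"
    by (auto simp: Cons.IH nths_Cons inversions_Suc_insert Compl_eq inj_image_mem_iff intro!: sum.cong)
  also have "(\<Sum>S\<in>Pow {..<?n}. ?g (Suc ` S)) =
      shuffle (\<lambda>Ys. (- 1) ^ length Ys * a Ys) (\<lambda>Ys. b (Z # Ys)) Zs"
  proof -
    have "length (nths Zs S) = card S" if "S \<subseteq> {..<?n}" for S
      using that by (auto simp: length_nths intro!: arg_cong[of _ _ card])
    then show ?thesis
      by (auto simp: Cons.IH nths_Cons inversions_Suc_image Compl_eq power_add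
          inj_image_mem_iff intro!: sum.cong)
  qed
  finally show ?case unfolding shuffle.simps length_Cons by (rule sym)
qed

lemma wedge_eq_shuffle: "wedge \<alpha> \<beta> Xs x = shuffle (\<lambda>Ys. \<alpha> Ys x) (\<lambda>Ys. \<beta> Ys x) Xs"
  by (simp add: wedge_def shuffle_eq_sum)

section \<open>Bilinearity, support and symmetry of the shuffle product\<close>

lemma shuffle_cong:
  assumes "\<And>Ys. set Ys \<subseteq> set Xs \<Longrightarrow> a Ys = a' Ys" "\<And>Ys. set Ys \<subseteq> set Xs \<Longrightarrow> b Ys = b' Ys"
  shows "shuffle a b Xs = shuffle a' b' Xs"
  unfolding shuffle_eq_sum by (simp add: assms set_nths_subset)

lemma shuffle_lincomb_left:
  "shuffle (\<lambda>Ys. c * a Ys + d * a' Ys) b Xs = c * shuffle a b Xs + d * shuffle a' b Xs"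
  by (simp add: shuffle_eq_sum sum_distrib_left sum.distrib algebra_simps)

lemma shuffle_lincomb_right:
  "shuffle a (\<lambda>Ys. c * b Ys + d * b' Ys) Xs = c * shuffle a b Xs + d * shuffle a b' Xs"
  by (simp add: shuffle_eq_sum sum_distrib_left sum.distrib algebra_simps)

lemma shuffle_cmult_left: "shuffle (\<lambda>Ys. c * a Ys) b Xs = c * shuffle a b Xs"
  using shuffle_lincomb_left[of c a 0 a b Xs] by simp

lemma shuffle_sign_left:
  "shuffle (\<lambda>Ys. (- 1) ^ length (Z # Ys) * a Ys) b Xs
     = - shuffle (\<lambda>Ys. (- 1) ^ length Ys * a Ys) b Xs"
  using shuffle_cmult_left[of "- 1" "\<lambda>Ys. (- 1) ^ length Ys * a Ys" b Xs] by simp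

lemma shuffle_diff_left: "shuffle (\<lambda>Ys. a Ys - a' Ys) b Xs = shuffle a b Xs - shuffle a' b Xs"
  using shuffle_lincomb_left[of 1 a "-1" a' b Xs] by simp

lemma shuffle_diff_right: "shuffle a (\<lambda>Ys. b Ys - b' Ys) Xs = shuffle a b Xs - shuffle a b' Xs"
  using shuffle_lincomb_right[of a 1 b "-1" b' Xs] by simp

lemma shuffle_add_left: "shuffle (\<lambda>Ys. a Ys + a' Ys) b Xs = shuffle a b Xs + shuffle a' b Xs"
  using shuffle_lincomb_left[of 1 a 1 a' b Xs] by simp

lemma shuffle_add_right: "shuffle a (\<lambda>Ys. b Ys + b' Ys) Xs = shuffle a b Xs + shuffle a b' Xs"
  using shuffle_lincomb_right[of a 1 b 1 b' Xs] by simp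

lemma shuffle_zero: "shuffle (\<lambda>_. 0) b Xs = 0" "shuffle a (\<lambda>_. 0) Xs = 0"
  by (simp_all add: shuffle_eq_sum)

lemma set_nths_Un_Compl: "set (nths Xs S) \<union> set (nths Xs (- S)) = set Xs"
  by (auto simp: set_nths in_set_conv_nth) blast

lemma length_nths_add_Compl: "length (nths Xs S) + length (nths Xs (- S)) = length Xs"
  by (induction Xs arbitrary: S) (simp_all add: nths_Cons Collect_neg_eq)

lemma shuffle_support:
  assumes "shuffle a b Xs \<noteq> 0"
    and "\<And>Ys. a Ys \<noteq> 0 \<Longrightarrow> length Ys = p \<and> set Ys \<subseteq> V"
    and "\<And>Ys. b Ys \<noteq> 0 \<Longrightarrow> length Ys = q \<and> set Ys \<subseteq> V"
  shows "length Xs = p + q \<and> set Xs \<subseteq> V"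
proof -
  obtain S where S: "a (nths Xs S) \<noteq> 0" "b (nths Xs (- S)) \<noteq> 0"
    using assms(1) unfolding shuffle_eq_sum by (metis (no_types, lifting) mult_eq_0_iff sum.neutral)
  show ?thesis using assms(2)[OF S(1)] assms(3)[OF S(2)]
      set_nths_Un_Compl[of Xs S]
      length_nths_add_Compl[of Xs S]
    by auto
qed

text \<open>For factors supported in a single length the length signs are constants. Peeling lowers
  \<open>p\<close> or \<open>q\<close> by one, and the factor \<open>(- 1) ^ q\<close> or
  \<open>(- 1) ^ p\<close> lost in the exponent is the crossing sign of the recursion.\<close>

lemma shuffle_commute:
  assumes "\<And>Ys. a Ys \<noteq> 0 \<Longrightarrow> length Ys = p" "\<And>Ys. b Ys \<noteq> 0 \<Longrightarrow> length Ys = q"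
  shows "shuffle a b Xs = (- 1) ^ (p * q) * shuffle b a Xs"
  using assms
proof (induction Xs arbitrary: a b p q)
  case Nil
  then show ?case
    using Nil(1)[of "[]"] by (cases "a [] = 0") (auto simp: mult.commute)
next
  case (Cons Z Zs)
  have hat: "(\<lambda>Ys. (- 1) ^ length Ys * a Ys) = (\<lambda>Ys. (- 1) ^ p * a Ys)"
    "(\<lambda>Ys. (- 1) ^ length Ys * b Ys) = (\<lambda>Ys. (- 1) ^ q * b Ys)"
    using Cons.prems by fastforce+
  have "shuffle (\<lambda>Ys. a (Z # Ys)) b Zs =
      (- 1) ^ (p * q) * ((- 1) ^ q * shuffle b (\<lambda>Ys. a (Z # Ys)) Zs)"
  \<comment> \<open>There is no degree \<open>p - 1\<close> when \<open>p = 0\<close>; then the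
    peeled factor vanishes, since \<open>Z # Ys\<close> is not empty.\<close>
  proof (cases p)
    case 0
    then have "(\<lambda>Ys. a (Z # Ys)) = (\<lambda>_. 0)" using Cons.prems(1) by fastforce
    then show ?thesis by (simp add: shuffle_zero)
  next
    case (Suc p')
    have "shuffle (\<lambda>Ys. a (Z # Ys)) b Zs = (- 1) ^ (p' * q) * shuffle b (\<lambda>Ys. a (Z # Ys)) Zs"
      by (rule Cons.IH) (use Cons.prems Suc in fastforce)+
    then show ?thesis by (simp add: Suc power_add flip: mult.assoc power_mult_distrib)
  qed
  moreover have "(- 1) ^ p * shuffle a (\<lambda>Ys. b (Z # Ys)) Zs =
      (- 1) ^ (p * q) * shuffle (\<lambda>Ys. b (Z # Ys)) a Zs"
  proof (cases q)
    case 0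
    then have "(\<lambda>Ys. b (Z # Ys)) = (\<lambda>_. 0)" using Cons.prems(2) by fastforce
    then show ?thesis by (simp add: shuffle_zero)
  next
    case (Suc q')
    have "shuffle a (\<lambda>Ys. b (Z # Ys)) Zs = (- 1) ^ (p * q') * shuffle (\<lambda>Ys. b (Z # Ys)) a Zs"
      by (rule Cons.IH) (use Cons.prems Suc in fastforce)+
    then show ?thesis by (simp add: Suc power_add)
  qed
  ultimately show ?case by (simp add: hat shuffle_cmult_left distrib_left)
qed

text \<open>The coefficients are real numbers because linearity over smooth functions is used at one
  point, with the values of the functions there. At position 0 the replaced entry is the one peeled
  off; later positions concern only the remaining list.\<close>

lemma shuffle_multilinear:
  assumes "\<And>Xs i. i < length Xs \<Longrightarrow> a (Xs[i := Z]) = c * a (Xs[i := X]) + d * a (Xs[i := Y])"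
    and "\<And>Xs i. i < length Xs \<Longrightarrow> b (Xs[i := Z]) = c * b (Xs[i := X]) + d * b (Xs[i := Y])"
    and "i < length Xs"
  shows "shuffle a b (Xs[i := Z]) = c * shuffle a b (Xs[i := X]) + d * shuffle a b (Xs[i := Y])"
  using assms
proof (induction Xs arbitrary: a b i)
  case Nil
  then show ?case by simp
next
  case (Cons W Ws)
  show ?case
  proof (cases i)
    case 0
    have "a (Z # Ys) = c * a (X # Ys) + d * a (Y # Ys)"
      "b (Z # Ys) = c * b (X # Ys) + d * b (Y # Ys)" for Ys
      using Cons.prems(1,2)[of 0 "W # Ys"] by simp_all
    then show ?thesis
      by (simp add: 0 shuffle_lincomb_left shuffle_lincomb_right algebra_simps)
  next
    case (Suc j)
    have j: "j < length Ws" using Cons.prems(3) Suc by simp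
    have a: "a (W # Xs[i := Z]) = c * a (W # Xs[i := X]) + d * a (W # Xs[i := Y])"
      if "i < length Xs" for Xs i
      using Cons.prems(1)[of "Suc i" "W # Xs"] that by simp
    have b: "b (W # Xs[i := Z]) = c * b (W # Xs[i := X]) + d * b (W # Xs[i := Y])"
      if "i < length Xs" for Xs i
      using Cons.prems(2)[of "Suc i" "W # Xs"] that by simp
    have *: "shuffle (\<lambda>Ys. a (W # Ys)) b (Ws[j := Z]) =
        c * shuffle (\<lambda>Ys. a (W # Ys)) b (Ws[j := X]) + d * shuffle (\<lambda>Ys. a (W # Ys)) b (Ws[j := Y])"
      using Cons.IH[of "\<lambda>Ys. a (W # Ys)" b j] a Cons.prems(2) j by blast
    let ?a = "\<lambda>Ys. (- 1) ^ length Ys * a Ys"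
    have "shuffle ?a (\<lambda>Ys. b (W # Ys)) (Ws[j := Z]) =
        c * shuffle ?a (\<lambda>Ys. b (W # Ys)) (Ws[j := X]) + d * shuffle ?a (\<lambda>Ys. b (W # Ys)) (Ws[j := Y])"
      by (rule Cons.IH) (use Cons.prems(1) b j in \<open>auto simp: algebra_simps\<close>)
    with * show ?thesis by (simp add: Suc algebra_simps)
  qed
qed

text \<open>If both copies of \<open>Z\<close> go to the same factor, the term is 0. If they are
  separated, the two ways of doing so differ by one crossing and cancel. Entries in front are peeled
  off, which the arbitrary prefix in the hypotheses permits.\<close>

lemma shuffle_repeat:
  assumes "\<And>us Z vs. a (us @ Z # Z # vs) = 0" "\<And>us Z vs. b (us @ Z # Z # vs) = 0"
  shows "shuffle a b (us @ Z # Z # vs) = 0"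
  using assms
proof (induction us arbitrary: a b)
  case Nil
  have "(\<lambda>Ys. a (Z # Z # Ys)) = (\<lambda>_. 0)" "(\<lambda>Ys. b (Z # Z # Ys)) = (\<lambda>_. 0)"
    using Nil[of "[]"] by simp_all
  then show ?case
    using shuffle_sign_left[of Z "\<lambda>Ys. a (Z # Ys)"] by (simp add: shuffle_zero)
next
  case (Cons U us)
  have "a (U # us @ Z # Z # vs) = 0" "b (U # us @ Z # Z # vs) = 0" for us Z vs
    using Cons.prems(1)[of "U # us"] Cons.prems(2)[of "U # us"] by simp_all
  then show ?case using Cons.IH Cons.prems by simp
qed


section \<open>Sums over removed entries\<close>

text \<open>The derivative half of Koszul's formula in abstract form. The minus sign is the shift by
  one of all positions behind \<open>Z\<close>.\<close>

primrec remove1_sum :: "('a \<Rightarrow> 'a list \<Rightarrow> real) \<Rightarrow> 'a list \<Rightarrow> real" where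
  "remove1_sum B [] = 0"
| "remove1_sum B (Z # Zs) = B Z Zs - remove1_sum (\<lambda>Y Ys. B Y (Z # Ys)) Zs"

text \<open>The bracket half. Two entries behind \<open>Z\<close> are both shifted, so their signs
  cancel; \<open>Z\<close> together with index \<open>j\<close> of the tail has sign
  \<open>(- 1) ^ (j + 1)\<close>, hence the minus.\<close>

primrec remove2_sum :: "('a \<Rightarrow> 'a \<Rightarrow> 'a list \<Rightarrow> real) \<Rightarrow> 'a list \<Rightarrow> real" where
  "remove2_sum B [] = 0"
| "remove2_sum B (Z # Zs) = remove2_sum (\<lambda>X Y Ys. B X Y (Z # Ys)) Zs - remove1_sum (B Z) Zs"

lemma nths_Cons_Compl:
  "nths (Z # Zs) (- {0}) = Zs"
  "nths (Z # Zs) (- {Suc i}) = Z # nths Zs (- {i})"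
  "nths (Z # Zs) (- {0, Suc i}) = nths Zs (- {i})"
  "nths (Z # Zs) (- {Suc i, Suc j}) = Z # nths Zs (- {i, j})"
  by (simp_all add: nths_Cons Compl_eq nths_all)

lemma remove1_sum_eq:
  "remove1_sum B Xs = (\<Sum>i<length Xs. (- 1) ^ i * B (Xs ! i) (nths Xs (- {i})))"
  by (induction Xs arbitrary: B)
    (simp_all add: sum.lessThan_Suc_shift nths_Cons_Compl sum_negf del: sum.lessThan_Suc)

lemma remove2_sum_eq:
  "remove2_sum B Xs =
     (\<Sum>j<length Xs. \<Sum>i<j. (- 1) ^ (i + j) * B (Xs ! i) (Xs ! j) (nths Xs (- {i, j})))"
  by (induction Xs arbitrary: B)
    (simp_all add: sum.lessThan_Suc_shift nths_Cons_Compl sum_negf sum_subtractf remove1_sum_eq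
      del: sum.lessThan_Suc)

lemma ext_d_eq:
  assumes "set Xs \<subseteq> vfields A"
  shows "ext_d A \<omega> Xs x = remove1_sum (\<lambda>Y Ys. Y (\<omega> Ys) x) Xs
     + remove2_sum (\<lambda>X Y Ys. \<omega> (lie_bracket X Y # Ys) x) Xs"
  using assms by (simp add: ext_d_def remove1_sum_eq remove2_sum_eq)

section \<open>Linearity and product rules for the removal sums\<close>

lemma remove1_sum_cong:
  assumes "\<And>Y Ys. Y \<in> set Xs \<Longrightarrow> set Ys \<subseteq> set Xs \<Longrightarrow> B Y Ys = B' Y Ys"
  shows "remove1_sum B Xs = remove1_sum B' Xs"
  unfolding remove1_sum_eq by (simp add: assms set_nths_subset)

lemma remove1_sum_lincomb:
  "remove1_sum (\<lambda>Y Ys. c * B Y Ys + d * B' Y Ys) Xs = c * remove1_sum B Xs + d * remove1_sum B' Xs"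
  by (simp add: remove1_sum_eq sum_distrib_left sum.distrib algebra_simps)

lemma remove2_sum_lincomb:
  "remove2_sum (\<lambda>X Y Ys. c * B X Y Ys + d * B' X Y Ys) Xs
     = c * remove2_sum B Xs + d * remove2_sum B' Xs"
  by (simp add: remove2_sum_eq sum_distrib_left sum.distrib algebra_simps)

lemma remove1_sum_add:
  "remove1_sum (\<lambda>Y Ys. B Y Ys + B' Y Ys) Xs = remove1_sum B Xs + remove1_sum B' Xs"
  using remove1_sum_lincomb[of 1 B 1 B' Xs] by simp

lemma remove2_sum_add:
  "remove2_sum (\<lambda>X Y Ys. B X Y Ys + B' X Y Ys) Xs = remove2_sum B Xs + remove2_sum B' Xs"
  using remove2_sum_lincomb[of 1 B 1 B' Xs] by simp

lemma remove1_sum_cmult: "remove1_sum (\<lambda>Y Ys. c * B Y Ys) Xs = c * remove1_sum B Xs"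
  using remove1_sum_lincomb[of c B 0 B Xs] by simp

lemma remove2_sum_cmult: "remove2_sum (\<lambda>X Y Ys. c * B X Y Ys) Xs = c * remove2_sum B Xs"
  using remove2_sum_lincomb[of c B 0 B Xs] by simp

text \<open>Every \<open>Ys\<close> that occurs is one entry shorter than \<open>Xs\<close>. This
  moves the length sign of \<open>shuffle\<close> through a removal.\<close>

lemma remove1_sum_sign:
  "remove1_sum (\<lambda>Y Ys. (- 1) ^ length Ys * B Y Ys) Xs = - ((- 1) ^ length Xs * remove1_sum B Xs)"
proof (induction Xs arbitrary: B)
  case (Cons Z Zs)
  have "remove1_sum (\<lambda>Y Ys. (- 1) ^ length (Z # Ys) * B Y (Z # Ys)) Zs
      = - remove1_sum (\<lambda>Y Ys. (- 1) ^ length Ys * B Y (Z # Ys)) Zs"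
    using remove1_sum_cmult[of "- 1" "\<lambda>Y Ys. (- 1) ^ length Ys * B Y (Z # Ys)" Zs] by simp
  then show ?case using Cons.IH by (simp add: algebra_simps)
qed simp

lemma remove2_sum_sign:
  "remove2_sum (\<lambda>X Y Ys. (- 1) ^ length Ys * B X Y Ys) Xs = (- 1) ^ length Xs * remove2_sum B Xs"
proof (induction Xs arbitrary: B)
  case (Cons Z Zs)
  have "remove2_sum (\<lambda>X Y Ys. (- 1) ^ length (Z # Ys) * B X Y (Z # Ys)) Zs
      = - remove2_sum (\<lambda>X Y Ys. (- 1) ^ length Ys * B X Y (Z # Ys)) Zs"
    using remove2_sum_cmult[of "- 1" "\<lambda>X Y Ys. (- 1) ^ length Ys * B X Y (Z # Ys)" Zs] by simp
  then show ?case using Cons.IH by (simp add: remove1_sum_sign right_diff_distrib)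
qed simp

text \<open>Removing an entry and distributing the rest amounts to distributing everything and
  removing the entry from the left block, where it reaches the front without crossing the right
  block.\<close>

lemma remove1_sum_shuffle_left:
  "remove1_sum (\<lambda>Y. shuffle (B Y) b) Xs = shuffle (remove1_sum B) b Xs"
proof (induction Xs arbitrary: B b)
  case (Cons Z Zs)
  \<comment> \<open>This minus cancels the one in the recursion of
    \<open>remove1_sum\<close>.\<close>
  have "remove1_sum (\<lambda>Y. shuffle (\<lambda>Ys. (- 1) ^ length Ys * B Y Ys) (\<lambda>Ys. b (Z # Ys))) Zs
      = - shuffle (\<lambda>Ys. (- 1) ^ length Ys * remove1_sum B Ys) (\<lambda>Ys. b (Z # Ys)) Zs"
    using shuffle_cmult_left[of "- 1" "\<lambda>Ys. (- 1) ^ length Ys * remove1_sum B Ys"]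
    by (simp add: Cons.IH remove1_sum_sign)
  then show ?case
    by (simp add: remove1_sum_add shuffle_diff_left Cons.IH)
qed (simp add: shuffle_zero)

text \<open>An entry removed from the right block crosses all arguments of \<open>a\<close> on its
  way to the front.\<close>

lemma remove1_sum_shuffle_right:
  "remove1_sum (\<lambda>Y. shuffle a (B Y)) Xs
     = shuffle (\<lambda>Ys. (- 1) ^ length Ys * a Ys) (remove1_sum B) Xs"
proof (induction Xs arbitrary: a B)
  case (Cons Z Zs)
  have "(\<lambda>Ys. (- 1) ^ length Ys * ((- 1) ^ length Ys * a Ys)) = a"
    by (simp flip: mult.assoc power_mult_distrib)
  then show ?case
    using shuffle_cmult_left[of "- 1" "\<lambda>Ys. (- 1) ^ length Ys * a (Z # Ys)"]
    by (simp add: remove1_sum_add shuffle_diff_right Cons.IH)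
qed (simp add: shuffle_zero)

lemma remove2_sum_shuffle_left:
  "remove2_sum (\<lambda>X Y. shuffle (B X Y) b) Xs = shuffle (remove2_sum B) b Xs"
proof (induction Xs arbitrary: B b)
  case (Cons Z Zs)
  then show ?case
    by (simp add: remove2_sum_add shuffle_diff_left remove1_sum_shuffle_left remove2_sum_sign)
qed (simp add: shuffle_zero)

text \<open>Two entries cross the arguments of \<open>a\<close>, so the signs cancel.\<close>

lemma remove2_sum_shuffle_right:
  "remove2_sum (\<lambda>X Y. shuffle a (B X Y)) Xs = shuffle a (remove2_sum B) Xs"
proof (induction Xs arbitrary: a B)
  case (Cons Z Zs)
  then show ?case
    by (simp add: remove2_sum_add shuffle_diff_right remove1_sum_shuffle_right)
qed (simp add: shuffle_zero)


section \<open>Exterior calculus\<close>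

lemma dforms_support:
  "\<omega> \<in> dforms A k \<Longrightarrow> \<omega> Xs x \<noteq> 0 \<Longrightarrow> length Xs = k \<and> set Xs \<subseteq> vfields A"
  unfolding dforms_def by (metis (mono_tags, lifting) mem_Collect_eq)

lemma dforms_smooth:
  assumes "\<omega> \<in> dforms A k"
  shows "\<omega> Xs \<in> smooth_funs A"
proof (cases "length Xs = k \<and> set Xs \<subseteq> vfields A")
  case True
  then show ?thesis using assms unfolding dforms_def by blast
next
  case False
  then have "\<omega> Xs = (\<lambda>_. 0)" using assms unfolding dforms_def by blast
  then show ?thesis by (simp add: smooth_funs_const)
qed

lemma dforms_repeat: "\<omega> \<in> dforms A k \<Longrightarrow> \<omega> (us @ Z # Z # vs) x = 0"
  unfolding dforms_def by simp

text \<open>Extension by zero makes this true for all lists, which is the form that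
  \<open>shuffle_multilinear\<close> requires.\<close>

lemma dforms_multilinear:
  assumes "\<omega> \<in> dforms A k" "X \<in> vfields A" "Y \<in> vfields A" "f \<in> smooth_funs A" "h \<in> smooth_funs A"
    and i: "i < length Xs"
  shows "\<omega> (Xs[i := vf_comb f X h Y]) x = f x * \<omega> (Xs[i := X]) x + h x * \<omega> (Xs[i := Y]) x"
proof (cases "length Xs = k \<and> set (Xs[i := X]) \<subseteq> vfields A")
  case True
  have "\<forall>Xs i. \<forall>X\<in>vfields A. \<forall>Y\<in>vfields A. \<forall>f\<in>smooth_funs A. \<forall>h\<in>smooth_funs A.
        length Xs = k \<and> set Xs \<subseteq> vfields A \<and> i < k \<longrightarrow>
        \<omega> (Xs[i := vf_comb f X h Y]) = (\<lambda>x. f x * \<omega> (Xs[i := X]) x + h x * \<omega> (Xs[i := Y]) x)"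
    using assms(1) unfolding dforms_def by simp
  \<comment> \<open>The entry of \<open>Xs\<close> at \<open>i\<close> need not be a vector field,
    so the rule is applied to \<open>Xs[i := X]\<close>.\<close>
  from this[rule_format, OF assms(2-5), of "Xs[i := X]" i] True i have "\<omega> (Xs[i := X, i := vf_comb f X h Y]) =
      (\<lambda>x. f x * \<omega> (Xs[i := X, i := X]) x + h x * \<omega> (Xs[i := X, i := Y]) x)"
    by simp
  then show ?thesis by simp
next
  case False
  have "\<not> (length (Xs[i := Z]) = k \<and> set (Xs[i := Z]) \<subseteq> vfields A)" for Z
  proof (cases "length Xs = k")
    case True
    \<comment> \<open>As \<open>X\<close> is a vector field, the offending entry sits at some
      \<open>j \<noteq> i\<close> and survives every replacement at \<open>i\<close>.\<close>
    with False i obtain W where "W \<in> set (Xs[i := X])" "W \<notin> vfields A" by auto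
    then obtain j where "j < length Xs" "Xs[i := X] ! j \<notin> vfields A"
      by (metis in_set_conv_nth length_list_update)
    with assms(2) i have "j < length Xs" "j \<noteq> i" "Xs ! j \<notin> vfields A" by (auto simp: nth_list_update split: if_splits)
    then have "Xs ! j \<in> set (Xs[i := Z])"
      by (metis length_list_update nth_list_update_neq nth_mem)
    with \<open>Xs ! j \<notin> vfields A\<close> show ?thesis by blast
  qed simp
  then show ?thesis using dforms_support[OF assms(1)] by (metis add.right_neutral mult_zero_right)
qed

text \<open>
  Vanishing on adjacent repetitions suffices: polarisation gives antisymmetry under adjacent
  transpositions, which moves two equal entries next to each other.
\<close>

lemma dformsI:
  assumes support: "\<And>Xs x. \<omega> Xs x \<noteq> 0 \<Longrightarrow> length Xs = k \<and> set Xs \<subseteq> vfields A"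
    and smooth: "\<And>Xs. \<omega> Xs \<in> smooth_funs A"
    and linear: "\<And>Xs i X Y f h x. X \<in> vfields A \<Longrightarrow> Y \<in> vfields A \<Longrightarrow> f \<in> smooth_funs A \<Longrightarrow>
      h \<in> smooth_funs A \<Longrightarrow> i < length Xs \<Longrightarrow>
      \<omega> (Xs[i := vf_comb f X h Y]) x = f x * \<omega> (Xs[i := X]) x + h x * \<omega> (Xs[i := Y]) x"
    and rep: "\<And>us Z vs x. \<omega> (us @ Z # Z # vs) x = 0"
  shows "\<omega> \<in> dforms A k"
proof -
  have add: "\<omega> (us @ vf_comb (\<lambda>_. 1) X (\<lambda>_. 1) Y # vs) x = \<omega> (us @ X # vs) x + \<omega> (us @ Y # vs) x"
    if "X \<in> vfields A" "Y \<in> vfields A" for us X Y vs x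
    using linear[OF that smooth_funs_const smooth_funs_const, of "length us" "us @ X # vs" 1 1]
    by (simp add: list_update_append)
  have swap: "\<omega> (us @ X # Y # vs) x = - \<omega> (us @ Y # X # vs) x"
    if "X \<in> vfields A" "Y \<in> vfields A" for us X Y vs x
  proof -
    let ?Z = "vf_comb (\<lambda>_. 1) X (\<lambda>_. 1) Y"
    have "0 = \<omega> (us @ ?Z # ?Z # vs) x" using rep by simp
    also have "\<dots> = \<omega> (us @ X # Y # vs) x + \<omega> (us @ Y # X # vs) x"
      using add[OF that, of us "?Z # vs"] add[OF that, of "us @ [X]"] add[OF that, of "us @ [Y]"]
      by (simp add: rep)
    finally show ?thesis by simp
  qed
  have rep': "\<omega> (us @ Z # vs @ Z # ws) x = 0" if "Z \<in> vfields A" "set vs \<subseteq> vfields A" for us Z vs ws x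
    using that
  proof (induction vs arbitrary: us)
    case (Cons V vs)
    then show ?case using swap[of Z V us "vs @ Z # ws" x] Cons.IH[of "us @ [V]"] by simp
  qed (simp add: rep)
  have "\<omega> Xs x = 0" if Xs: "\<not> distinct Xs" for Xs x
  proof (rule ccontr)
    assume "\<omega> Xs x \<noteq> 0"
    moreover obtain us vs ws Z where "Xs = us @ Z # vs @ Z # ws"
      using not_distinct_decomp[OF Xs] by auto
    ultimately show False using rep' support[of Xs x] by auto
  qed
  then show ?thesis
    unfolding dforms_def using support smooth linear by blast
qed

lemma dforms_zero: "(\<lambda>_ _. 0) \<in> dforms A k"
  by (rule dformsI) (auto simp: smooth_funs_const)

lemma dforms_lincomb:
  assumes "smooth_atlas A" "\<alpha> \<in> dforms A k" "\<beta> \<in> dforms A k"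
  shows "(\<lambda>Xs x. c * \<alpha> Xs x + d * \<beta> Xs x) \<in> dforms A k"
proof (rule dformsI)
  show "length Xs = k \<and> set Xs \<subseteq> vfields A" if "c * \<alpha> Xs x + d * \<beta> Xs x \<noteq> 0" for Xs x
    using that dforms_support[OF assms(2), of Xs x] dforms_support[OF assms(3), of Xs x]
    by (cases "\<alpha> Xs x = 0") auto
qed (auto simp: smooth_funs_lincomb assms dforms_smooth[OF assms(2)] dforms_smooth[OF assms(3)]
    dforms_multilinear[OF assms(2)] dforms_multilinear[OF assms(3)] algebra_simps
    dforms_repeat[OF assms(2)] dforms_repeat[OF assms(3)])

section \<open>The wedge product of differential forms\<close>

lemma shuffle_smooth:
  assumes A: "smooth_atlas A" and "\<And>Ys. \<alpha> Ys \<in> smooth_funs A" "\<And>Ys. \<beta> Ys \<in> smooth_funs A"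
  shows "(\<lambda>x. shuffle (\<lambda>Ys. \<alpha> Ys x) (\<lambda>Ys. \<beta> Ys x) Xs) \<in> smooth_funs A"
  using assms(2,3)
proof (induction Xs arbitrary: \<alpha> \<beta>)
  case Nil
  then show ?case by (simp add: smooth_funs_mult[OF A])
next
  case (Cons Z Zs)
  have "(\<lambda>x. shuffle (\<lambda>Ys. \<alpha> (Z # Ys) x) (\<lambda>Ys. \<beta> Ys x) Zs) \<in> smooth_funs A"
    by (rule Cons.IH) (rule Cons.prems)+
  moreover have "(\<lambda>x. shuffle (\<lambda>Ys. (- 1) ^ length Ys * \<alpha> Ys x) (\<lambda>Ys. \<beta> (Z # Ys) x) Zs)
      \<in> smooth_funs A"
    by (rule Cons.IH) (use Cons.prems smooth_funs_cmult[OF A] in auto)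
  ultimately show ?case by (simp add: smooth_funs_add[OF A])
qed

text \<open>The length sign is a constant for each list, so \<open>X\<close> passes through it and
  the recursion reduces the claim to the Leibniz rule for a single product.\<close>

lemma vfield_shuffle:
  assumes A: "smooth_atlas A" and "\<And>Ys. \<alpha> Ys \<in> smooth_funs A" "\<And>Ys. \<beta> Ys \<in> smooth_funs A"
    and X: "X \<in> vfields A"
  shows "X (\<lambda>x. shuffle (\<lambda>Ys. \<alpha> Ys x) (\<lambda>Ys. \<beta> Ys x) Xs) x =
    shuffle (\<lambda>Ys. X (\<alpha> Ys) x) (\<lambda>Ys. \<beta> Ys x) Xs + shuffle (\<lambda>Ys. \<alpha> Ys x) (\<lambda>Ys. X (\<beta> Ys) x) Xs"
  using assms(2,3)
proof (induction Xs arbitrary: \<alpha> \<beta>)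
  case Nil
  then show ?case by (simp add: vfield_mult[OF X])
next
  case (Cons Z Zs)
  let ?\<alpha> = "\<lambda>Ys x. (- 1) ^ length Ys * \<alpha> Ys x"
  have \<alpha>: "?\<alpha> Ys \<in> smooth_funs A" for Ys
    using Cons.prems(1) smooth_funs_cmult[OF A] by blast
  have "X (\<lambda>x. shuffle (\<lambda>Ys. \<alpha> Ys x) (\<lambda>Ys. \<beta> Ys x) (Z # Zs)) x =
     X (\<lambda>x. shuffle (\<lambda>Ys. \<alpha> (Z # Ys) x) (\<lambda>Ys. \<beta> Ys x) Zs) x
     + X (\<lambda>x. shuffle (\<lambda>Ys. ?\<alpha> Ys x) (\<lambda>Ys. \<beta> (Z # Ys) x) Zs) x"
    using vfield_add[OF X shuffle_smooth[OF A, of "\<lambda>Ys. \<alpha> (Z # Ys)" \<beta> Zs]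
        shuffle_smooth[OF A, of ?\<alpha> "\<lambda>Ys. \<beta> (Z # Ys)" Zs]]
    by (simp add: Cons.prems \<alpha>)
  also have "X (\<lambda>x. shuffle (\<lambda>Ys. \<alpha> (Z # Ys) x) (\<lambda>Ys. \<beta> Ys x) Zs) x =
      shuffle (\<lambda>Ys. X (\<alpha> (Z # Ys)) x) (\<lambda>Ys. \<beta> Ys x) Zs
      + shuffle (\<lambda>Ys. \<alpha> (Z # Ys) x) (\<lambda>Ys. X (\<beta> Ys) x) Zs"
    by (rule Cons.IH) (rule Cons.prems)+
  also have "X (\<lambda>x. shuffle (\<lambda>Ys. ?\<alpha> Ys x) (\<lambda>Ys. \<beta> (Z # Ys) x) Zs) x =
      shuffle (\<lambda>Ys. X (?\<alpha> Ys) x) (\<lambda>Ys. \<beta> (Z # Ys) x) Zs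
      + shuffle (\<lambda>Ys. ?\<alpha> Ys x) (\<lambda>Ys. X (\<beta> (Z # Ys)) x) Zs"
    by (rule Cons.IH) (rule \<alpha> Cons.prems)+
  finally show ?case by (simp add: vfield_cmult[OF X Cons.prems(1)])
qed

lemma wedge_in_dforms:
  assumes A: "smooth_atlas A" and \<alpha>: "\<alpha> \<in> dforms A p" and \<beta>: "\<beta> \<in> dforms A q"
  shows "wedge \<alpha> \<beta> \<in> dforms A (p + q)"
proof (rule dformsI)
  fix Xs x
  assume "wedge \<alpha> \<beta> Xs x \<noteq> 0"
  then have "shuffle (\<lambda>Ys. \<alpha> Ys x) (\<lambda>Ys. \<beta> Ys x) Xs \<noteq> 0" by (simp add: wedge_eq_shuffle)
  then show "length Xs = p + q \<and> set Xs \<subseteq> vfields A"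
    by (rule shuffle_support) (use dforms_support \<alpha> \<beta> in blast)+
next
  fix Xs
  have "wedge \<alpha> \<beta> Xs = (\<lambda>x. shuffle (\<lambda>Ys. \<alpha> Ys x) (\<lambda>Ys. \<beta> Ys x) Xs)"
    by (simp add: wedge_eq_shuffle fun_eq_iff)
  then show "wedge \<alpha> \<beta> Xs \<in> smooth_funs A"
    using shuffle_smooth[OF A dforms_smooth[OF \<alpha>] dforms_smooth[OF \<beta>]] by simp
next
  fix Xs :: "'a vfield list" and i X Y f h x
  assume "X \<in> vfields A" "Y \<in> vfields A" "f \<in> smooth_funs A" "h \<in> smooth_funs A" "i < length Xs"
  then show "wedge \<alpha> \<beta> (Xs[i := vf_comb f X h Y]) x =
      f x * wedge \<alpha> \<beta> (Xs[i := X]) x + h x * wedge \<alpha> \<beta> (Xs[i := Y]) x"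
    unfolding wedge_eq_shuffle by (intro shuffle_multilinear) (use dforms_multilinear \<alpha> \<beta> in blast)+
next
  fix us vs :: "'a vfield list" and Z x
  show "wedge \<alpha> \<beta> (us @ Z # Z # vs) x = 0"
    unfolding wedge_eq_shuffle
    by (rule shuffle_repeat) (simp_all add: dforms_repeat[OF \<alpha>] dforms_repeat[OF \<beta>])
qed

lemma wedge_commute:
  assumes "\<alpha> \<in> dforms A p" "\<beta> \<in> dforms A q"
  shows "wedge \<alpha> \<beta> Xs x = (- 1) ^ (p * q) * wedge \<beta> \<alpha> Xs x"
  unfolding wedge_eq_shuffle
  by (rule shuffle_commute) (use dforms_support assms in blast)+

lemma wedge_zero: "wedge (\<lambda>_ _. 0) \<beta> = (\<lambda>_ _. 0)" "wedge \<alpha> (\<lambda>_ _. 0) = (\<lambda>_ _. 0)"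
  by (simp_all add: wedge_eq_shuffle shuffle_zero fun_eq_iff)

text \<open>The shape of the sum is that of the curves in \<open>has_variation\<close>.\<close>

lemma wedge_add_cmult_left:
  "wedge (\<lambda>Ys y. \<alpha> Ys y + t * \<alpha>' Ys y) \<beta> Xs x = wedge \<alpha> \<beta> Xs x + t * wedge \<alpha>' \<beta> Xs x"
  using shuffle_lincomb_left[of 1 "\<lambda>Ys. \<alpha> Ys x" t] by (simp add: wedge_eq_shuffle)

lemma wedge_add_cmult_right:
  "wedge \<alpha> (\<lambda>Ys y. \<beta> Ys y + t * \<beta>' Ys y) Xs x = wedge \<alpha> \<beta> Xs x + t * wedge \<alpha> \<beta>' Xs x"
  using shuffle_lincomb_right[of "\<lambda>Ys. \<alpha> Ys x" 1 "\<lambda>Ys. \<beta> Ys x" t] by (simp add: wedge_eq_shuffle)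

lemma ext_d_add_cmult:
  assumes "\<alpha> \<in> dforms A k" "\<beta> \<in> dforms A k"
  shows "ext_d A (\<lambda>Ys y. \<alpha> Ys y + t * \<beta> Ys y) Xs x = ext_d A \<alpha> Xs x + t * ext_d A \<beta> Xs x"
proof (cases "set Xs \<subseteq> vfields A")
  case True
  have "Y (\<lambda>y. \<alpha> Ys y + t * \<beta> Ys y) x = 1 * Y (\<alpha> Ys) x + t * Y (\<beta> Ys) x"
    if "Y \<in> set Xs" for Y Ys
    using vfield_lincomb[OF _ dforms_smooth[OF assms(1)] dforms_smooth[OF assms(2)], of Y 1 Ys t Ys]
      that True by auto
  then have "remove1_sum (\<lambda>Y Ys. Y (\<lambda>y. \<alpha> Ys y + t * \<beta> Ys y) x) Xs =
      1 * remove1_sum (\<lambda>Y Ys. Y (\<alpha> Ys) x) Xs + t * remove1_sum (\<lambda>Y Ys. Y (\<beta> Ys) x) Xs"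
    unfolding remove1_sum_lincomb[symmetric] by (rule remove1_sum_cong)
  moreover have "remove2_sum (\<lambda>X Y Ys. \<alpha> (lie_bracket X Y # Ys) x
        + t * \<beta> (lie_bracket X Y # Ys) x) Xs =
      1 * remove2_sum (\<lambda>X Y Ys. \<alpha> (lie_bracket X Y # Ys) x) Xs
      + t * remove2_sum (\<lambda>X Y Ys. \<beta> (lie_bracket X Y # Ys) x) Xs"
    unfolding remove2_sum_lincomb[symmetric] by simp
  ultimately show ?thesis by (simp add: ext_d_eq[OF True] algebra_simps)
qed (simp add: ext_d_def)

lemma ext_d_support: "ext_d A \<omega> Xs x \<noteq> 0 \<Longrightarrow> set Xs \<subseteq> vfields A"
  by (simp add: ext_d_def split: if_splits)

lemma ext_d_zero: "ext_d A (\<lambda>_ _. 0) = (\<lambda>_ _. 0)"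
  by (auto simp: fun_eq_iff ext_d_def vfield_zero[of _ A]
      subset_iff intro!: sum.neutral)

text \<open>The sign \<open>(- 1) ^ p\<close> arises differently in the two halves: in the first the
  removed field crosses the arguments of \<open>\<alpha>\<close>; in the second the two removed
  fields cross without a sign, but their bracket, put in front, crosses back into
  \<open>\<beta>\<close>.\<close>

lemma ext_d_wedge:
  assumes A: "smooth_atlas A" and \<alpha>: "\<alpha> \<in> dforms A p" and \<beta>: "\<beta> \<in> dforms A q"
  shows "ext_d A (wedge \<alpha> \<beta>) Xs x
    = wedge (ext_d A \<alpha>) \<beta> Xs x + (- 1) ^ p * wedge \<alpha> (ext_d A \<beta>) Xs x"
proof (cases "set Xs \<subseteq> vfields A")
  case True
  let ?a = "\<lambda>Ys. \<alpha> Ys x" and ?b = "\<lambda>Ys. \<beta> Ys x"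
  let ?a1 = "\<lambda>Y Ys. Y (\<alpha> Ys) x" and ?b1 = "\<lambda>Y Ys. Y (\<beta> Ys) x"
  let ?a2 = "\<lambda>X Y Ys. \<alpha> (lie_bracket X Y # Ys) x" and ?b2 = "\<lambda>X Y Ys. \<beta> (lie_bracket X Y # Ys) x"
  \<comment> \<open>Off length \<open>p\<close> both sides are 0.\<close>
  have sign: "(\<lambda>Ys. (- 1) ^ length Ys * \<alpha> Ys x) = (\<lambda>Ys. (- 1) ^ p * \<alpha> Ys x)"
    using dforms_support[OF \<alpha>] by fastforce
  have wedge: "wedge \<alpha> \<beta> Ys = (\<lambda>x. shuffle (\<lambda>Ys. \<alpha> Ys x) (\<lambda>Ys. \<beta> Ys x) Ys)" for Ys
    by (simp add: wedge_eq_shuffle fun_eq_iff)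
  have "remove1_sum (\<lambda>Y Ys. Y (wedge \<alpha> \<beta> Ys) x) Xs =
      remove1_sum (\<lambda>Y Ys. shuffle (?a1 Y) ?b Ys + shuffle ?a (?b1 Y) Ys) Xs"
    unfolding wedge using True
    by (intro remove1_sum_cong vfield_shuffle[OF A dforms_smooth[OF \<alpha>] dforms_smooth[OF \<beta>]]) auto
  also have "\<dots> = shuffle (remove1_sum ?a1) ?b Xs + (- 1) ^ p * shuffle ?a (remove1_sum ?b1) Xs"
    by (simp add: remove1_sum_add remove1_sum_shuffle_left remove1_sum_shuffle_right sign
        shuffle_cmult_left)
  finally have 1: "remove1_sum (\<lambda>Y Ys. Y (wedge \<alpha> \<beta> Ys) x) Xs = \<dots>" .
  have "remove2_sum (\<lambda>X Y Ys. wedge \<alpha> \<beta> (lie_bracket X Y # Ys) x) Xs =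
      shuffle (remove2_sum ?a2) ?b Xs + (- 1) ^ p * shuffle ?a (remove2_sum ?b2) Xs"
    by (simp add: wedge_eq_shuffle remove2_sum_add remove2_sum_shuffle_left
        remove2_sum_shuffle_right remove2_sum_cmult sign shuffle_cmult_left)
  \<comment> \<open>\<open>ext_d_eq\<close> holds only on lists of vector fields, and
    \<open>shuffle\<close> evaluates its factors only on sublists of \<open>Xs\<close>.\<close>
  moreover have "shuffle (\<lambda>Ys. ext_d A \<alpha> Ys x) ?b Xs =
      shuffle (\<lambda>Ys. remove1_sum ?a1 Ys + remove2_sum ?a2 Ys) ?b Xs"
    using True by (intro shuffle_cong) (auto simp: ext_d_eq)
  moreover have "shuffle ?a (\<lambda>Ys. ext_d A \<beta> Ys x) Xs =
      shuffle ?a (\<lambda>Ys. remove1_sum ?b1 Ys + remove2_sum ?b2 Ys) Xs"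
    using True by (intro shuffle_cong) (auto simp: ext_d_eq)
  ultimately show ?thesis
    unfolding ext_d_eq[OF True] 1
    by (simp add: wedge_eq_shuffle shuffle_add_left shuffle_add_right algebra_simps)
next
  case False
  \<comment> \<open>However \<open>Xs\<close> is split, one factor receives an entry that is not a
    vector field, so both sides vanish.\<close>
  have "\<not> (set (nths Xs S) \<subseteq> vfields A \<and> set (nths Xs (- S)) \<subseteq> vfields A)" for S
    using False set_nths_Un_Compl[of Xs S] by blast
  then have "ext_d A \<alpha> (nths Xs S) x * \<beta> (nths Xs (- S)) x = 0"
    "\<alpha> (nths Xs S) x * ext_d A \<beta> (nths Xs (- S)) x = 0" for S
    using dforms_support[OF \<alpha>, of "nths Xs S" x] dforms_support[OF \<beta>, of "nths Xs (- S)" x]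
      ext_d_support[of A \<alpha> "nths Xs S" x] ext_d_support[of A \<beta> "nths Xs (- S)" x]
    by (metis mult_eq_0_iff)+
  then have "wedge (ext_d A \<alpha>) \<beta> Xs x = 0" "wedge \<alpha> (ext_d A \<beta>) Xs x = 0"
    by (simp_all add: wedge_def mult.assoc sum.neutral)
  then show ?thesis using ext_d_support[of A "wedge \<alpha> \<beta>" Xs x] False by auto
qed


section \<open>Gauge transformations\<close>

lemma UNIV_gauge_gen: "(UNIV :: gauge_gen set) = {V3, V6}"
  using gauge_gen.exhaust by blast

lemma all_gauge_gen: "(\<forall>a. P a) \<longleftrightarrow> P V3 \<and> P V6"
  by (metis gauge_gen.exhaust)

lemma gen_nth: "gen a $ b = (if a = b then 1 else 0)"
  by (simp add: gen_def axis_def)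

lemma parameter_bracket_V3: "parameter_bracket \<Lambda> \<Lambda>' V3 = (\<lambda>_ _. 0)"
  by (simp add: parameter_bracket_def gauge_brackets_def gauge_bracket_def gen_nth)

text \<open>The sign \<open>(- 1) ^ (3 * 3)\<close> cancels the minus in
  \<open>[v_3, v_3] = - v_6\<close>.\<close>

lemma parameter_bracket_V6: "parameter_bracket \<Lambda> \<Lambda>' V6 = wedge (\<Lambda> V3) (\<Lambda>' V3)"
  by (simp add: parameter_bracket_def gauge_brackets_def gauge_bracket_def gen_nth UNIV_gauge_gen)

lemma gauge_variation_in_potentials:
  assumes "smooth_atlas A" "\<Lambda> \<in> gauge_parameters A" "C \<in> potentials A"
  shows "gauge_variation \<Lambda> C \<in> potentials A"
proof -
  have "\<Lambda> V3 \<in> dforms A 3" "\<Lambda> V6 \<in> dforms A 6" "C V3 \<in> dforms A 3"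
    using assms(2,3) by (auto simp: gauge_parameters_def potentials_def all_gauge_gen)
  then show ?thesis
    using dforms_lincomb[OF assms(1), of "\<Lambda> V6" 6 "wedge (\<Lambda> V3) (C V3)" 1 "- 1 / 2"]
      wedge_in_dforms[OF assms(1), of "\<Lambda> V3" 3 "C V3" 3]
    by (simp add: potentials_def all_gauge_gen)
qed

lemma field_strength_invariant:
  assumes "\<Lambda> \<in> gauge_parameters A" "C \<in> potentials A"
  shows "field_strength A (\<lambda>a Ys y. C a Ys y + t * gauge_variation \<Lambda> C a Ys y) = field_strength A C"
proof -
  have "\<Lambda> V3 \<in> dforms A 3" "ext_d A (\<Lambda> V3) = (\<lambda>_ _. 0)" "C V3 \<in> dforms A 3"
    using assms by (auto simp: gauge_parameters_def potentials_def all_gauge_gen)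
  then show ?thesis by (simp add: field_strength_def ext_d_add_cmult fun_eq_iff)
qed

lemma duality_lhs_invariant:
  assumes A: "smooth_atlas A" and \<Lambda>: "\<Lambda> \<in> gauge_parameters A" and C: "C \<in> potentials A"
  shows "duality_lhs A g vol (\<lambda>a Ys y. C a Ys y + t * gauge_variation \<Lambda> C a Ys y)
    = duality_lhs A g vol C"
proof -
  have forms: "\<Lambda> V3 \<in> dforms A 3" "\<Lambda> V6 \<in> dforms A 6" "C V3 \<in> dforms A 3" "C V6 \<in> dforms A 6"
    and closed: "ext_d A (\<Lambda> V3) = (\<lambda>_ _. 0)" "ext_d A (\<Lambda> V6) = (\<lambda>_ _. 0)"
    using \<Lambda> C by (auto simp: gauge_parameters_def potentials_def all_gauge_gen)
  have w: "wedge (\<Lambda> V3) (C V3) \<in> dforms A 6"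
    using wedge_in_dforms[OF A forms(1,3)] by simp
  have \<delta>: "gauge_variation \<Lambda> C V6 \<in> dforms A 6"
    using gauge_variation_in_potentials[OF A \<Lambda> C] by (simp add: potentials_def all_gauge_gen)
  \<comment> \<open>The degree sign \<open>(- 1) ^ 3\<close> of the product rule turns the
    coefficient -1/2 into 1/2.\<close>
  have "ext_d A (gauge_variation \<Lambda> C V6) Xs x = 1 / 2 * wedge (\<Lambda> V3) (field_strength A C) Xs x"
    for Xs x
  proof -
    have "gauge_variation \<Lambda> C V6 = (\<lambda>Ys y. \<Lambda> V6 Ys y + (- 1 / 2) * wedge (\<Lambda> V3) (C V3) Ys y)"
      by (simp add: fun_eq_iff)
    then have "ext_d A (gauge_variation \<Lambda> C V6) Xs x = - 1 / 2 * ext_d A (wedge (\<Lambda> V3) (C V3)) Xs x"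
      using ext_d_add_cmult[OF forms(2) w, of "- 1 / 2" Xs x] closed by simp
    then show ?thesis
      using ext_d_wedge[OF A forms(1,3), of Xs x] by (simp add: closed wedge_zero field_strength_def)
  qed
  \<comment> \<open>The variation of C_6 stays folded, so that linearity of \<open>ext_d\<close>
    treats it as one 6-form.\<close>
  then show ?thesis
    unfolding duality_lhs_def field_strength_invariant[OF \<Lambda> C]
    by (simp add: fun_eq_iff ext_d_add_cmult[OF forms(4) \<delta>] wedge_add_cmult_left algebra_simps
        del: gauge_variation.simps(2))
qed

text \<open>Each field equation is constant in t, so its derivative vanishes at every potential and
  in particular at the solutions.\<close>

lemma gauge_variation_symmetry:
  assumes A: "smooth_atlas A" and \<Lambda>: "\<Lambda> \<in> gauge_parameters A"
  shows "infinitesimal_symmetry A g vol (gauge_variation \<Lambda>)"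
  using gauge_variation_in_potentials[OF A \<Lambda>] field_strength_invariant[OF \<Lambda>]
    duality_lhs_invariant[OF A \<Lambda>]
  by (auto simp: infinitesimal_symmetry_def solutions_def field_equations_def has_variation_def
      bianchi_lhs_def eom_lhs_def)

section \<open>Commutators of gauge transformations\<close>

lemma parameter_bracket_closed:
  assumes A: "smooth_atlas A" and "\<Lambda> \<in> gauge_parameters A" "\<Lambda>' \<in> gauge_parameters A"
  shows "parameter_bracket \<Lambda> \<Lambda>' \<in> gauge_parameters A"
proof -
  have forms: "\<Lambda> V3 \<in> dforms A 3" "\<Lambda>' V3 \<in> dforms A 3"
    and closed: "ext_d A (\<Lambda> V3) = (\<lambda>_ _. 0)" "ext_d A (\<Lambda>' V3) = (\<lambda>_ _. 0)"
    using assms(2,3) by (auto simp: gauge_parameters_def all_gauge_gen)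
  have "ext_d A (wedge (\<Lambda> V3) (\<Lambda>' V3)) = (\<lambda>_ _. 0)"
    by (intro ext) (simp add: ext_d_wedge[OF A forms] closed wedge_zero)
  then show ?thesis
    using wedge_in_dforms[OF A forms]
    by (simp add: gauge_parameters_def all_gauge_gen parameter_bracket_V3 parameter_bracket_V6
        dforms_zero ext_d_zero)
qed

text \<open>Only the variation of C_6 depends on the potential, and only through C_3. The bracket
  has no \<open>V3\<close> component, so its own variation is independent of C.\<close>

lemma gauge_variation_commutator:
  assumes "\<Lambda> \<in> gauge_parameters A" "\<Lambda>' \<in> gauge_parameters A"
  shows "is_commutator A (gauge_variation \<Lambda>) (gauge_variation \<Lambda>')
    (gauge_variation (parameter_bracket \<Lambda> \<Lambda>'))"
proof -
  have forms: "\<Lambda> V3 \<in> dforms A 3" "\<Lambda>' V3 \<in> dforms A 3"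
    using assms by (auto simp: gauge_parameters_def all_gauge_gen)
  have V3: "has_variation (\<lambda>C'. gauge_variation \<Lambda> C' V3) C D (\<lambda>_ _. 0)" for \<Lambda> C D :: "'a gforms"
    by (simp add: has_variation_def)
  have V6: "has_variation (\<lambda>C'. gauge_variation \<Lambda> C' V6) C D
      (\<lambda>Xs x. - 1 / 2 * wedge (\<Lambda> V3) (D V3) Xs x)" for \<Lambda> C D :: "'a gforms"
    unfolding has_variation_def gauge_variation.simps wedge_add_cmult_right
    by (auto intro!: derivative_eq_intros)
  have eq3: "gauge_variation (parameter_bracket \<Lambda> \<Lambda>') C V3 = (\<lambda>Xs x. 0 - 0)" for C
    by (simp add: parameter_bracket_V3)
  \<comment> \<open>Exchanging two 3-forms gives \<open>(- 1) ^ 9\<close>, so the halves add instead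
    of cancelling.\<close>
  have eq6: "gauge_variation (parameter_bracket \<Lambda> \<Lambda>') C V6 =
      (\<lambda>Xs x. - 1 / 2 * wedge (\<Lambda>' V3) (gauge_variation \<Lambda> C V3) Xs x
         - - 1 / 2 * wedge (\<Lambda> V3) (gauge_variation \<Lambda>' C V3) Xs x)" for C
    using wedge_commute[OF forms]
    by (simp add: parameter_bracket_V3 parameter_bracket_V6 wedge_zero fun_eq_iff)
  show ?thesis
    unfolding is_commutator_def all_gauge_gen
    by (intro ballI conjI exI, rule V3, rule V3, rule eq3, rule V6, rule V6, rule eq6)
qed


section \<open>The gauge algebra\<close>

lemma gauge_vec_eq_iff: "(x :: real ^ gauge_gen) = y \<longleftrightarrow> x $ V3 = y $ V3 \<and> x $ V6 = y $ V6"
  by (simp add: vec_eq_iff all_gauge_gen)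

lemma gauge_grading_iff:
  "x \<in> gauge_grading k \<longleftrightarrow> (x $ V3 \<noteq> 0 \<longrightarrow> k = 3) \<and> (x $ V6 \<noteq> 0 \<longrightarrow> k = 6)"
  by (auto simp: gauge_grading_def all_gauge_gen)

lemma gauge_grading_graded: "graded_vector_space gauge_grading"
  unfolding graded_vector_space_def
proof (intro conjI allI)
  show "subspace (gauge_grading k)" for k
    by (auto simp: subspace_def gauge_grading_iff)
next
  fix x :: "real ^ gauge_gen"
  \<comment> \<open>The index set of the sum depends on \<open>f\<close>; for a graded family it
    lies in \<open>{3, 6}\<close>, which gives a formula uniform in \<open>f\<close>.\<close>
  have sum_eq: "(\<Sum>k | f k \<noteq> 0. f k) = f 3 + f 6" if "\<forall>k. f k \<in> gauge_grading k"
    for f :: "int \<Rightarrow> real ^ gauge_gen"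
  proof -
    have "f k = 0" if "k \<notin> {3, 6}" for k
      using \<open>\<forall>k. f k \<in> gauge_grading k\<close> that by (auto simp: gauge_grading_iff gauge_vec_eq_iff)
    then have "(\<Sum>k | f k \<noteq> 0. f k) = (\<Sum>k\<in>{3, 6}. f k)"
      by (intro sum.mono_neutral_left) auto
    then show ?thesis by simp
  qed
  define f :: "int \<Rightarrow> real ^ gauge_gen" where
    "f k = (if k = 3 then x $ V3 *\<^sub>R gen V3 else if k = 6 then x $ V6 *\<^sub>R gen V6 else 0)" for k
  show "\<exists>!f. (\<forall>k. f k \<in> gauge_grading k) \<and> finite {k. f k \<noteq> 0} \<and> x = (\<Sum>k | f k \<noteq> 0. f k)"
  proof (rule ex1I[of _ f])
    have *: "\<forall>k. f k \<in> gauge_grading k" by (auto simp: f_def gauge_grading_iff gen_nth)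
    moreover have "finite {k. f k \<noteq> 0}"
      by (rule finite_subset[of _ "{3, 6}"]) (auto simp: f_def)
    ultimately show "(\<forall>k. f k \<in> gauge_grading k) \<and> finite {k. f k \<noteq> 0} \<and> x = (\<Sum>k | f k \<noteq> 0. f k)"
      unfolding sum_eq[OF *] by (simp add: f_def gauge_vec_eq_iff gen_nth)
  next
    fix h :: "int \<Rightarrow> real ^ gauge_gen"
    assume h: "(\<forall>k. h k \<in> gauge_grading k) \<and> finite {k. h k \<noteq> 0} \<and> x = (\<Sum>k | h k \<noteq> 0. h k)"
    then have "x = h 3 + h 6" using sum_eq by simp
    moreover have "k \<noteq> 3 \<Longrightarrow> h k $ V3 = 0" "k \<noteq> 6 \<Longrightarrow> h k $ V6 = 0" for k
      using h by (auto simp: gauge_grading_iff)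
    ultimately show "h = f"
      by (intro ext) (auto simp: f_def gauge_vec_eq_iff gen_nth)
  qed
qed

text \<open>The bracket is symmetric, which is graded antisymmetry for two odd arguments. For
  homogeneous arguments not both of degree 3, the product of the \<open>V3\<close> components is 0
  and any sign will do.\<close>

lemma gauge_brackets_symmetric:
  assumes "length xs = n" "homogeneous gauge_grading ds xs" "\<sigma> permutes {..<n}"
  shows "gauge_brackets n (map (\<lambda>i. xs ! \<sigma> i) [0..<n]) = perm_sign ds \<sigma> *\<^sub>R gauge_brackets n xs"
proof (cases "n = 2")
  case True
  then obtain x y where xs: "xs = [x, y]"
    using assms(1) by (auto simp: numeral_2_eq_2 length_Suc_conv)
  obtain d e where ds: "ds = [d, e]" and x: "x \<in> gauge_grading d" and y: "y \<in> gauge_grading e"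
    using assms(2) by (auto simp: homogeneous_def xs list_all2_Cons2)
  have map: "map (\<lambda>i. xs ! \<sigma> i) [0..<n] = [xs ! \<sigma> 0, xs ! \<sigma> 1]"
    by (simp add: True numeral_2_eq_2)
  have br: "gauge_bracket x y = gauge_bracket y x" by (simp add: gauge_bracket_def)
  have "\<sigma> 0 \<in> {0, 1}" "\<sigma> 1 \<in> {0, 1}" "\<sigma> 0 \<noteq> \<sigma> 1"
    using permutes_in_image[OF assms(3), of 0] permutes_in_image[OF assms(3), of 1]
      permutes_inj[OF assms(3)] by (auto simp: True inj_def)
  then consider "\<sigma> 0 = 0" "\<sigma> 1 = 1" | "\<sigma> 0 = 1" "\<sigma> 1 = 0" by auto
  then show ?thesis
  proof cases
    case 1
    have "{(a, b). a < b \<and> b < length ds \<and> \<sigma> b < \<sigma> a} = {}"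
      using 1 by (auto simp: ds less_Suc_eq)
    then have "perm_sign ds \<sigma> = 1" unfolding perm_sign_def by (simp only: prod.empty)
    then show ?thesis
      using 1 True by (simp add: map gauge_brackets_def xs)
  next
    case 2
    have "{(a, b). a < b \<and> b < length ds \<and> \<sigma> b < \<sigma> a} = {(0, 1)}"
      using 2 by (auto simp: ds less_Suc_eq)
    then have "perm_sign ds \<sigma> = swap_sign e d"
      using 2 by (simp add: perm_sign_def ds)
    moreover have "gauge_bracket x y = swap_sign e d *\<^sub>R gauge_bracket x y"
      using x y by (auto simp: gauge_bracket_def gauge_grading_iff swap_sign_def)
    ultimately show ?thesis
      using 2 True br by (simp add: map gauge_brackets_def xs)
  qed
qed (simp add: gauge_brackets_def)

text \<open>
  Only the binary bracket is nonzero and its values have no component along \<open>v\<^sub>3\<close>, so every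
  composite of two brackets vanishes.
\<close>

lemma gauge_brackets_nested:
  "gauge_brackets m (gauge_brackets i xs # ys) = 0"
  by (simp add: gauge_brackets_def gauge_bracket_def gen_nth)

lemma gauge_brackets_L_infinity: "L_infinity_algebra gauge_grading gauge_brackets"
  unfolding L_infinity_algebra_def
proof (intro conjI allI impI)
  show "graded_vector_space gauge_grading" by (rule gauge_grading_graded)
next
  fix n i :: nat and xs :: "(real ^ gauge_gen) list"
  assume "length xs = n \<and> i < n"
  then have "i = 0 \<or> i = 1" if "n = 2" using that by auto
  then show "linear (\<lambda>x. gauge_brackets n (xs[i := x]))"
    using \<open>length xs = n \<and> i < n\<close>
    by (cases "n = 2")
      (auto intro!: linearI simp: gauge_brackets_def gauge_bracket_def algebra_simps linear_zero)
next
  fix n ds and xs :: "(real ^ gauge_gen) list"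
  assume *: "length xs = n \<and> homogeneous gauge_grading ds xs"
  \<comment> \<open>The binary bracket has degree 0, and it is nonzero only on two arguments of
    degree 3, with value in degree 6; the zero vector lies in every degree.\<close>
  show "gauge_brackets n xs \<in> gauge_grading (sum_list ds + int n - 2)"
  proof (cases "n = 2")
    case True
    then obtain x y where xs: "xs = [x, y]"
      using * by (auto simp: numeral_2_eq_2 length_Suc_conv)
    then obtain d e where "ds = [d, e]" "x \<in> gauge_grading d" "y \<in> gauge_grading e"
      using * by (auto simp: homogeneous_def list_all2_Cons2)
    then show ?thesis
      by (auto simp: True xs gauge_brackets_def gauge_bracket_def gauge_grading_iff gen_nth)
  qed (simp add: gauge_brackets_def gauge_grading_iff)
qed (simp_all add: gauge_brackets_symmetric gauge_brackets_nested)

theorem theorem4p1: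
  fixes A :: "('m::{t2_space, second_countable_topology}, 11) atlas"
    and g :: "'m metric" and vol :: "'m dform"
  assumes "lorentzian_spacetime A g vol"
  shows "(\<forall>\<Lambda>\<in>gauge_parameters A. infinitesimal_symmetry A g vol (gauge_variation \<Lambda>)) \<and>
    (\<forall>\<Lambda>\<in>gauge_parameters A. \<forall>\<Lambda>'\<in>gauge_parameters A.
        parameter_bracket \<Lambda> \<Lambda>' \<in> gauge_parameters A \<and>
        is_commutator A (gauge_variation \<Lambda>) (gauge_variation \<Lambda>')
          (gauge_variation (parameter_bracket \<Lambda> \<Lambda>'))) \<and>
    L_infinity_algebra gauge_grading gauge_brackets"
proof -
  have "smooth_atlas A" using assms by (simp add: lorentzian_spacetime_def)
  then show ?thesis
    by (simp add: gauge_variation_symmetry parameter_bracket_closed gauge_variation_commutator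
        gauge_brackets_L_infinity)
qed

end
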